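(* Let $\mathcal M=\{A,B,C,D\}$ be a minimal continuous-time system with $A\in\mathbb C^{n\times n}$, $B\in\mathbb C^{n\times m}$, $C\in\mathbb C^{m\times n}$, $D\in\mathbb C^{m\times m}$ and $\operatorname{rank}B=\operatorname{rank}C=m$, put $R:=D+D^{\mathsf H}$, and assume that the set $$\mathbb X_c:=\{X=X^{\mathsf H}\in\mathbb C^{n\times n} : W_c(X)\succ 0,\ X\succ 0\}$$ is non-empty. For $X\in\mathbb X_c$ define $$F_c:=R^{-1}(C-B^{\mathsf H}X),\qquad P_c:=-A^{\mathsf H}X-XA-F_c^{\mathsf H}RF_c,\qquad A_{F_c}:=A-BF_c .$$ Then $P_c\succ 0$ for every $X\in\mathbb X_c$, and $X\in\mathbb X_c$ is the analytic center of $\mathbb X_c$ if and only if $$P_c\,A_{F_c}+A_{F_c}^{\mathsf H}P_c=0,$$ equivalently $P_c^{-1}A_{F_c}^{\mathsf H}+A_{F_c}P_c^{-1}=0$. Moreover, at the analytic center, $P_c^{1/2}A_{F_c}P_c^{-1/2}$ is skew-Hermitian (where $P_c^{1/2}$ is the positive definite Hermitian square root), so all eigenvalues of $A_{F_c}$ lie on the imaginary axis.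
   Context: $V^{\mathsf H}$ denotes the conjugate transpose; $\succ 0$ means Hermitian positive definite. The system $\{A,B,C,D\}$ is minimal if $\operatorname{rank}[\lambda I-A\ \ B]=n$ for all $\lambda\in\mathbb C$ (controllability of $(A,B)$) and $(A^{\mathsf H},C^{\mathsf H})$ is controllable. For Hermitian $X\in\mathbb C^{n\times n}$, $$W_c(X):=\begin{bmatrix}-XA-A^{\mathsf H}X & C^{\mathsf H}-XB\\ C-B^{\mathsf H}X & D+D^{\mathsf H}\end{bmatrix}.$$ The analytic center of $\mathbb X_c$ is the minimizer over $\mathbb X_c$ of the barrier function $b(X)=-\ln\det W_c(X)$. *)

theory Defs
  imports
    "Jordan_Normal_Form.Schur_Decomposition"
    "Jordan_Normal_Form.Gauss_Jordan_Elimination"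
    "Jordan_Normal_Form.DL_Rank"
begin

notation mat_adjoint (\<open>_\<^sup>H\<close> [1000] 1000)

(* (M *\<^sub>v v) \<bullet>c v is v^H M v; it is real because M is Hermitian. *)
definition positive_definite :: "complex mat \<Rightarrow> bool" where
  "positive_definite M \<longleftrightarrow>
     square_mat M \<and> M\<^sup>H = M \<and>
     (\<forall>v \<in> carrier_vec (dim_row M). v \<noteq> 0\<^sub>v (dim_row M) \<longrightarrow> 0 < Re ((M *\<^sub>v v) \<bullet>c v))"

definition skew_hermitian :: "complex mat \<Rightarrow> bool" where
  "skew_hermitian M \<longleftrightarrow> square_mat M \<and> M\<^sup>H = - M"

definition mat_inv :: "complex mat \<Rightarrow> complex mat" where
  "mat_inv M = the (mat_inverse M)"

definition pd_sqrt :: "complex mat \<Rightarrow> complex mat" where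
  "pd_sqrt M = (THE Q. positive_definite Q \<and> Q * Q = M)"

(* The block row [M N], as a 2x2 block matrix whose lower blocks have no rows
   (compare append_rows in the matrix library). *)
definition block_row :: "complex mat \<Rightarrow> complex mat \<Rightarrow> complex mat" where
  "block_row M N = four_block_mat M N (0\<^sub>m 0 (dim_col M)) (0\<^sub>m 0 (dim_col N))"

(* The first argument of vec_space.rank is the number of rows. *)
definition controllable :: "complex mat \<Rightarrow> complex mat \<Rightarrow> bool" where
  "controllable A B \<longleftrightarrow>
     (\<forall>l :: complex. vec_space.rank (dim_row A)
        (block_row (l \<cdot>\<^sub>m 1\<^sub>m (dim_row A) - A) B) = dim_row A)"

definition minimal_system :: "complex mat \<Rightarrow> complex mat \<Rightarrow> complex mat \<Rightarrow> bool" where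
  "minimal_system A B C \<longleftrightarrow> controllable A B \<and> controllable (A\<^sup>H) (C\<^sup>H)"

definition Wc :: "complex mat \<Rightarrow> complex mat \<Rightarrow> complex mat \<Rightarrow> complex mat \<Rightarrow> complex mat \<Rightarrow> complex mat" where
  "Wc A B C D X =
     four_block_mat (- (X * A) - A\<^sup>H * X) (C\<^sup>H - X * B)
                    (C - B\<^sup>H * X)          (D + D\<^sup>H)"

definition Xc :: "complex mat \<Rightarrow> complex mat \<Rightarrow> complex mat \<Rightarrow> complex mat \<Rightarrow> complex mat set" where
  "Xc A B C D =
     {X \<in> carrier_mat (dim_row A) (dim_row A).
        X\<^sup>H = X \<and> positive_definite (Wc A B C D X) \<and> positive_definite X}"

(* On Xc the determinant is real and positive, so Re only changes its type. *)
definition barrier :: "complex mat \<Rightarrow> complex mat \<Rightarrow> complex mat \<Rightarrow> complex mat \<Rightarrow> complex mat \<Rightarrow> real" where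
  "barrier A B C D X = - ln (Re (det (Wc A B C D X)))"

(* X is \<open>the\<close> minimizer: a minimizer, and the only one. *)
definition is_analytic_center ::
    "complex mat \<Rightarrow> complex mat \<Rightarrow> complex mat \<Rightarrow> complex mat \<Rightarrow> complex mat \<Rightarrow> bool" where
  "is_analytic_center A B C D X \<longleftrightarrow>
     is_arg_min (barrier A B C D) (\<lambda>Y. Y \<in> Xc A B C D) X \<and>
     (\<forall>Y. is_arg_min (barrier A B C D) (\<lambda>Z. Z \<in> Xc A B C D) Y \<longrightarrow> Y = X)"

definition Fc :: "complex mat \<Rightarrow> complex mat \<Rightarrow> complex mat \<Rightarrow> complex mat \<Rightarrow> complex mat" where
  "Fc B C D X = mat_inv (D + D\<^sup>H) * (C - B\<^sup>H * X)"

definition Pc :: "complex mat \<Rightarrow> complex mat \<Rightarrow> complex mat \<Rightarrow> complex mat \<Rightarrow> complex mat \<Rightarrow> complex mat" where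
  "Pc A B C D X =
     - (A\<^sup>H * X) - X * A - (Fc B C D X)\<^sup>H * (D + D\<^sup>H) * Fc B C D X"

definition AFc :: "complex mat \<Rightarrow> complex mat \<Rightarrow> complex mat \<Rightarrow> complex mat \<Rightarrow> complex mat \<Rightarrow> complex mat" where
  "AFc A B C D X = A - B * Fc B C D X"

end

theory Submission
  imports Defs "Jordan_Normal_Form.Spectral_Radius"
begin

text \<open>
  Write \<open>W(X)\<close> for \<open>Wc A B C D X\<close>; it is affine in \<open>X\<close>. Completing the square, that is, conjugating by
  \<open>T = [I 0; -F I]\<close>, turns \<open>W(X)\<close> into \<open>diag(P, R)\<close>, and its linear part \<open>dW \<Delta>\<close> into a matrix with zero
  lower right block and upper left block \<open>- \<Delta> A\<^sub>F - A\<^sub>F\<^sup>H \<Delta>\<close>. Hence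
  \<open>tr (W(X)\<^sup>-\<^sup>1 dW \<Delta>) = - tr (\<Delta> G)\<close> with \<open>G = A\<^sub>F P\<^sup>-\<^sup>1 + P\<^sup>-\<^sup>1 A\<^sub>F\<^sup>H\<close>.

  Diagonalizing \<open>W(X)\<close> and \<open>dW \<Delta>\<close> by one congruence gives
  \<open>det W(X + t \<Delta>) = det W(X) \<Prod>(1 + t d\<^sub>i)\<close> with \<open>\<Sum>d\<^sub>i\<close> the above trace. If \<open>G \<noteq> 0\<close>, the direction \<open>\<Delta> = - G\<close>
  increases the determinant. If \<open>G = 0\<close>, then \<open>\<Prod>(1 + d\<^sub>i) \<le> exp (\<Sum>d\<^sub>i) = 1\<close>, with equality only for
  \<open>dW \<Delta> = 0\<close>, which controllability of \<open>(A, B)\<close> excludes for \<open>\<Delta> \<noteq> 0\<close>.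
\<close>

section \<open>Adjoint, arithmetic and trace of complex matrices\<close>

text \<open>The definition of the analytic center asks for a unique minimizer, so the comparison
  with every other feasible point has to be strict; the equality case of the product estimate must
  therefore be settled, and that is where controllability enters. The trace formula is short because
  \<open>R\<close> does not involve \<open>X\<close>: the conjugated \<open>dW \<Delta>\<close> has
  a zero lower right block, and its off-diagonal blocks do not meet the block diagonal inverse, so
  only the upper left block counts. The simultaneous congruence replaces calculus of the
  log-determinant and convexity of the feasible set. It gives one list of numbers \<open>d i\<close>
  valid for all real \<open>t\<close>: small \<open>t\<close> shows that a center is critical, and
  \<open>t = 1\<close> reaches an arbitrary feasible point, so that a critical point is a global
  minimizer. A small step must also keep both \<open>W(X)\<close> and \<open>X\<close> positive
  definite, which the same pencil argument provides for each. The equation of the theorem is the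
  condition \<open>G = 0\<close> after congruence with \<open>P\<close>.\<close>

lemma dim_mat_adjoint [simp]:
  "dim_row (M\<^sup>H) = dim_col M" "dim_col (M\<^sup>H) = dim_row M"
  by (simp_all add: mat_adjoint_def)

lemma index_mat_adjoint [simp]:
  "i < dim_col M \<Longrightarrow> j < dim_row M \<Longrightarrow> M\<^sup>H $$ (i, j) = conjugate (M $$ (j, i))"
  by (simp add: mat_adjoint_def mat_of_rows_def)

lemma mat_adjoint_carrier [simp]: "M\<^sup>H \<in> carrier_mat a b \<longleftrightarrow> M \<in> carrier_mat b a"
  unfolding carrier_mat_def by (simp add: conj_commute)

lemma mat_adjoint_adjoint [simp]: "(M\<^sup>H)\<^sup>H = (M :: complex mat)"
  by (rule eq_matI) auto

lemma mat_adjoint_one [simp]: "(1\<^sub>m n)\<^sup>H = (1\<^sub>m n :: complex mat)"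
  by (rule eq_matI) auto

lemma mat_adjoint_zero [simp]: "(0\<^sub>m a b)\<^sup>H = (0\<^sub>m b a :: complex mat)"
  by (rule eq_matI) auto

lemma mat_adjoint_uminus [simp]: "(- M)\<^sup>H = - (M\<^sup>H :: complex mat)"
  by (rule eq_matI) auto

lemma mat_adjoint_add:
  fixes M N :: "complex mat"
  assumes "dim_row M = dim_row N" "dim_col M = dim_col N"
  shows "(M + N)\<^sup>H = M\<^sup>H + N\<^sup>H"
  by (rule eq_matI) (use assms in auto)

lemma mat_adjoint_mult:
  fixes M N :: "complex mat"
  assumes "dim_col M = dim_row N"
  shows "(M * N)\<^sup>H = N\<^sup>H * M\<^sup>H"
  by (rule eq_matI)
    (use assms in \<open>auto simp: scalar_prod_def sum_conjugate mult.commute intro!: sum.cong\<close>)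

lemma mat_adjoint_four_block:
  fixes M1 M2 M3 M4 :: "complex mat"
  assumes "M1 \<in> carrier_mat a b" "M2 \<in> carrier_mat a c" "M3 \<in> carrier_mat d b" "M4 \<in> carrier_mat d c"
  shows "(four_block_mat M1 M2 M3 M4)\<^sup>H = four_block_mat (M1\<^sup>H) (M3\<^sup>H) (M2\<^sup>H) (M4\<^sup>H)"
  by (rule eq_matI) (use assms in auto)

lemma mat_adjoint_diag [simp]:
  "(mat_diag n (\<lambda>i. complex_of_real (d i)))\<^sup>H = mat_diag n (\<lambda>i. complex_of_real (d i))"
  by (rule eq_matI) (auto simp: mat_diag_def)

lemma cscalar_prod_adjoint:
  fixes M :: "complex mat"
  assumes "M \<in> carrier_mat a b" "v \<in> carrier_vec b" "w \<in> carrier_vec a"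
  shows "(M *\<^sub>v v) \<bullet>c w = v \<bullet>c (M\<^sup>H *\<^sub>v w)"
proof -
  have "(M *\<^sub>v v) \<bullet>c w = (\<Sum>i<a. \<Sum>j<b. M $$ (i,j) * v $ j * cnj (w $ i))"
    using assms by (auto simp: scalar_prod_def sum_distrib_right lessThan_atLeast0 intro!: sum.cong)
  also have "\<dots> = (\<Sum>j<b. \<Sum>i<a. M $$ (i,j) * v $ j * cnj (w $ i))"
    by (rule sum.swap)
  also have "\<dots> = v \<bullet>c (M\<^sup>H *\<^sub>v w)"
    using assms by (auto simp: scalar_prod_def sum_distrib_left lessThan_atLeast0 intro!: sum.cong)
  finally show ?thesis .
qed

lemma cscalar_prod_self:
  fixes v :: "complex vec"
  assumes "v \<in> carrier_vec n"
  shows "v \<bullet>c v = complex_of_real (\<Sum>i<n. (cmod (v $ i))\<^sup>2)"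
proof -
  have "v \<bullet>c v = (\<Sum>i<n. v $ i * cnj (v $ i))"
    using assms by (simp add: scalar_prod_def lessThan_atLeast0)
  then show ?thesis by (simp only: complex_norm_square of_real_sum)
qed

text \<open>The library rules carry carrier premises with unknown dimensions; with dimension equations as
  premises instead, the simplifier discharges them unaided.\<close>

lemma mat_mult_assoc:
  fixes M :: "complex mat"
  assumes "dim_col M = dim_row N" "dim_col N = dim_row K"
  shows "(M * N) * K = M * (N * K)"
  by (rule assoc_mult_mat[of _ "dim_row M" "dim_col M" _ "dim_col N" _ "dim_col K"])
    (rule carrier_matI; simp add: assms)+

lemma mat_distrib_left:
  fixes M :: "complex mat"
  assumes "dim_col M = dim_row N" "dim_row N = dim_row K" "dim_col N = dim_col K"
  shows "M * (N + K) = M * N + M * K"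
  by (rule mult_add_distrib_mat[of _ "dim_row M" "dim_col M" _ "dim_col N"])
    (rule carrier_matI; simp add: assms)+

lemma mat_distrib_right:
  fixes M :: "complex mat"
  assumes "dim_col M = dim_row K" "dim_row N = dim_row M" "dim_col N = dim_col M"
  shows "(M + N) * K = M * K + N * K"
  by (rule add_mult_distrib_mat[of _ "dim_row M" "dim_col M" _ _ "dim_col K"])
    (rule carrier_matI; simp add: assms)+

lemma mat_minus_conv:
  fixes M :: "complex mat"
  assumes "dim_row N = dim_row M" "dim_col N = dim_col M"
  shows "M - N = M + - N"
  by (rule eq_matI) (use assms in auto)

lemma mat_add_assoc:
  fixes M :: "complex mat"
  assumes "dim_row M = dim_row N" "dim_col M = dim_col N" "dim_row N = dim_row K" "dim_col N = dim_col K"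
  shows "(M + N) + K = M + (N + K)"
  by (rule eq_matI) (use assms in auto)

lemma mat_add_commute:
  fixes M :: "complex mat"
  assumes "dim_row M = dim_row N" "dim_col M = dim_col N"
  shows "M + N = N + M"
  by (rule eq_matI) (use assms in auto)

lemma mat_add_left_commute:
  fixes M :: "complex mat"
  assumes "dim_row M = dim_row N" "dim_col M = dim_col N" "dim_row N = dim_row K" "dim_col N = dim_col K"
  shows "M + (N + K) = N + (M + K)"
  by (rule eq_matI) (use assms in auto)

lemma mat_uminus_add:
  fixes M :: "complex mat"
  assumes "dim_row M = dim_row N" "dim_col M = dim_col N"
  shows "- (M + N) = - M + - N"
  by (rule eq_matI) (use assms in auto)

lemma mat_add_cancel:
  fixes M :: "complex mat"
  shows "M + - M = 0\<^sub>m (dim_row M) (dim_col M)" "- M + M = 0\<^sub>m (dim_row M) (dim_col M)"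
  by (rule eq_matI; auto)+

lemma mat_add_cancel_left:
  fixes M N :: "complex mat"
  assumes "dim_row M = dim_row N" "dim_col M = dim_col N"
  shows "M + (- M + N) = N" "- M + (M + N) = N"
  by (rule eq_matI; use assms in auto)+

lemma mat_add_zero:
  fixes M :: "complex mat"
  assumes "dim_row M = a" "dim_col M = b"
  shows "M + 0\<^sub>m a b = M" "0\<^sub>m a b + M = M"
  by (rule eq_matI; use assms in auto)+

lemma mat_uminus_zero: "- (0\<^sub>m a b) = (0\<^sub>m a b :: complex mat)"
  by (rule eq_matI) auto

lemma mat_mult_zero:
  fixes M :: "complex mat"
  shows "dim_col M = a \<Longrightarrow> M * 0\<^sub>m a b = 0\<^sub>m (dim_row M) b"
    "dim_row M = b \<Longrightarrow> 0\<^sub>m a b * M = 0\<^sub>m a (dim_col M)"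
  by auto

lemma mat_mult_one:
  fixes M :: "complex mat"
  shows "dim_col M = a \<Longrightarrow> M * 1\<^sub>m a = M" "dim_row M = a \<Longrightarrow> 1\<^sub>m a * M = M"
  by auto

lemma mat_mult_uminus:
  fixes M N :: "complex mat"
  assumes "dim_col M = dim_row N"
  shows "(- M) * N = - (M * N)" "M * (- N) = - (M * N)"
  using assms by simp_all

lemma mat_mult_smult:
  fixes M N :: "complex mat"
  assumes "dim_col M = dim_row N"
  shows "(c \<cdot>\<^sub>m M) * N = c \<cdot>\<^sub>m (M * N)" "M * (c \<cdot>\<^sub>m N) = c \<cdot>\<^sub>m (M * N)"
  by (rule mult_smult_assoc_mat[of _ "dim_row M" "dim_col M" _ "dim_col N"]
      mult_smult_distrib[of _ "dim_row M" "dim_col M" _ "dim_col N"];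
      (rule carrier_matI)?; simp add: assms)+

lemma mat_smult_add:
  fixes M N :: "complex mat"
  assumes "dim_row M = dim_row N" "dim_col M = dim_col N"
  shows "c \<cdot>\<^sub>m (M + N) = c \<cdot>\<^sub>m M + c \<cdot>\<^sub>m N"
  by (rule eq_matI) (use assms in \<open>auto simp: algebra_simps\<close>)

lemma mat_smult_uminus: "c \<cdot>\<^sub>m (- M) = - (c \<cdot>\<^sub>m (M :: complex mat))"
  by (rule eq_matI) auto

text \<open>Products are nested to the right, so \<open>M * N\<close> rarely occurs as a subterm;
  this form cancels the pair in front of a remaining factor.\<close>

lemma mat_inverse_cancel:
  fixes M N K :: "complex mat"
  assumes "M * N = 1\<^sub>m n" "dim_col M = dim_row N" "dim_col N = dim_row K" "dim_row K = n"
  shows "M * (N * K) = K"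
  using assms by (metis mat_mult_assoc mat_mult_one(2))

text \<open>A normal form for block computations: differences become sums with negatives, adjoints
  move to the factors, products are expanded and nested to the right, sums are sorted and opposite
  terms cancelled. It is meant for \<open>simp only\<close> together with dimension facts, which
  discharge the side conditions.\<close>

lemmas mat_ring_simps =
  mat_mult_assoc mat_distrib_left mat_distrib_right mat_minus_conv mat_add_assoc mat_add_commute
  mat_add_left_commute mat_uminus_add mat_add_cancel mat_add_cancel_left mat_add_zero mat_uminus_zero mat_mult_zero
  mat_mult_one mat_mult_uminus uminus_uminus_mat mat_adjoint_mult mat_adjoint_add
  mat_adjoint_adjoint mat_adjoint_uminus mat_adjoint_one mat_adjoint_zero
  index_add_mat(2,3) index_minus_mat(2,3) index_mult_mat(2,3) index_uminus_mat(2,3)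
  index_smult_mat(2,3) index_one_mat(2,3) index_zero_mat(2,3) dim_mat_adjoint

lemma mat_add_eq_0_iff:
  fixes M N :: "complex mat"
  assumes "M \<in> carrier_mat a b" "N \<in> carrier_mat a b"
  shows "M + N = 0\<^sub>m a b \<longleftrightarrow> N = - M"
proof
  assume *: "M + N = 0\<^sub>m a b"
  show "N = - M"
  proof (rule eq_matI)
    fix i j assume "i < dim_row (- M)" "j < dim_col (- M)"
    then show "N $$ (i, j) = (- M) $$ (i, j)"
      using arg_cong[OF *, of "\<lambda>K. K $$ (i, j)"] assms
      by (simp add: eq_neg_iff_add_eq_0 add.commute)
  qed (use assms in auto)
next
  assume "N = - M"
  then show "M + N = 0\<^sub>m a b"
    using carrier_matD[OF assms(1)] by (simp only: mat_ring_simps)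
qed

section \<open>Trace and Frobenius norm\<close>

definition mat_trace :: "complex mat \<Rightarrow> complex" where
  "mat_trace M = (\<Sum>i<dim_row M. M $$ (i, i))"

lemma mat_trace_mult_commute:
  assumes "M \<in> carrier_mat a b" "N \<in> carrier_mat b a"
  shows "mat_trace (M * N) = mat_trace (N * M)"
proof -
  have "mat_trace (M * N) = (\<Sum>i<a. \<Sum>j<b. M $$ (i,j) * N $$ (j,i))"
    using assms by (auto simp: mat_trace_def scalar_prod_def lessThan_atLeast0 intro!: sum.cong)
  also have "\<dots> = (\<Sum>j<b. \<Sum>i<a. M $$ (i,j) * N $$ (j,i))"
    by (rule sum.swap)
  also have "\<dots> = mat_trace (N * M)"
    using assms by (auto simp: mat_trace_def scalar_prod_def lessThan_atLeast0 mult.commute intro!: sum.cong)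
  finally show ?thesis .
qed

lemma mat_trace_add:
  "M \<in> carrier_mat n n \<Longrightarrow> N \<in> carrier_mat n n \<Longrightarrow> mat_trace (M + N) = mat_trace M + mat_trace N"
  by (auto simp: mat_trace_def sum.distrib)

lemma mat_trace_uminus: "M \<in> carrier_mat n n \<Longrightarrow> mat_trace (- M) = - mat_trace M"
  by (auto simp: mat_trace_def sum_negf)

lemma mat_trace_four_block:
  assumes "M1 \<in> carrier_mat a a" "M4 \<in> carrier_mat b b"
  shows "mat_trace (four_block_mat M1 M2 M3 M4) = mat_trace M1 + mat_trace M4"
proof -
  have "mat_trace (four_block_mat M1 M2 M3 M4)
      = (\<Sum>i<a+b. if i < a then M1 $$ (i,i) else M4 $$ (i - a, i - a))"
    using assms by (auto simp: mat_trace_def intro!: sum.cong)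
  also have "\<dots> = (\<Sum>i<a. M1 $$ (i,i)) + (\<Sum>i<b. M4 $$ (i,i))"
    by (induction b) auto
  finally show ?thesis using assms by (auto simp: mat_trace_def)
qed

lemma mat_trace_adjoint_mult:
  assumes "M \<in> carrier_mat a b"
  shows "mat_trace (M\<^sup>H * M) = complex_of_real (\<Sum>j<b. \<Sum>i<a. (cmod (M $$ (i,j)))\<^sup>2)"
proof -
  have "mat_trace (M\<^sup>H * M) = (\<Sum>j<b. \<Sum>i<a. M $$ (i,j) * cnj (M $$ (i,j)))"
    using assms by (auto simp: mat_trace_def scalar_prod_def lessThan_atLeast0 intro!: sum.cong)
  then show ?thesis by (simp only: complex_norm_square of_real_sum)
qed

text \<open>Definiteness of the squared Frobenius norm. The premise is an inequality so that the
  contrapositive gives a strictly positive trace for a nonzero matrix.\<close>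

lemma mat_trace_adjoint_mult_eq_0:
  assumes "M \<in> carrier_mat a b" "Re (mat_trace (M\<^sup>H * M)) \<le> 0"
  shows "M = 0\<^sub>m a b"
proof -
  have "(\<Sum>j<b. \<Sum>i<a. (cmod (M $$ (i,j)))\<^sup>2) = 0"
    using assms(2) unfolding mat_trace_adjoint_mult[OF assms(1)] Re_complex_of_real
    by (intro antisym sum_nonneg) auto
  then have "\<forall>j<b. (\<Sum>i<a. (cmod (M $$ (i,j)))\<^sup>2) = 0"
    by (subst (asm) sum_nonneg_eq_0_iff) (auto intro: sum_nonneg)
  then have "\<forall>j<b. \<forall>i<a. M $$ (i,j) = 0"
    by (subst (asm) sum_nonneg_eq_0_iff) auto
  with assms(1) show ?thesis by (intro eq_matI) auto
qed

section \<open>Spectral theorem\<close>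

lemma dim_mat_diag [simp]: "dim_row (mat_diag n f) = n" "dim_col (mat_diag n f) = n"
  by (simp_all add: mat_diag_def)

lemma mat_diag_Suc_block:
  "mat_diag (Suc k) (\<lambda>i. case i of 0 \<Rightarrow> e | Suc j \<Rightarrow> d j)
    = four_block_mat (mat 1 1 (\<lambda>_. e)) (0\<^sub>m 1 k) (0\<^sub>m k 1) (mat_diag k d)"
  by (rule eq_matI) (auto simp: mat_diag_def split: nat.splits)

lemma mult_block_diag:
  fixes M1 M4 :: "complex mat"
  assumes "M1 \<in> carrier_mat a a" "M4 \<in> carrier_mat b b" "N1 \<in> carrier_mat a a" "N4 \<in> carrier_mat b b"
  shows "four_block_mat M1 (0\<^sub>m a b) (0\<^sub>m b a) M4 * four_block_mat N1 (0\<^sub>m a b) (0\<^sub>m b a) N4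
    = four_block_mat (M1 * N1) (0\<^sub>m a b) (0\<^sub>m b a) (M4 * N4)"
proof -
  have "M1 * N1 \<in> carrier_mat a a" "M4 * N4 \<in> carrier_mat b b" using assms by auto
  then show ?thesis
    by (subst mult_four_block_mat[OF assms(1) _ _ assms(2) assms(3) _ _ assms(4)])
      (use assms in \<open>auto simp: mat_mult_zero mat_add_zero\<close>)
qed

text \<open>\<open>corthogonal\<close> gives orthogonality but not unit length; dividing every
  vector by its norm makes the columns orthonormal.\<close>

lemma normalize_corthogonal:
  fixes ws :: "complex vec list"
  assumes ws: "set ws \<subseteq> carrier_vec n" "corthogonal ws" "length ws = n"
  defines "U \<equiv> mat n n (\<lambda>(i, j). ws ! j $ i / complex_of_real (sqrt (Re (ws ! j \<bullet>c ws ! j))))"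
  shows "U\<^sup>H * U = 1\<^sub>m n"
proof (rule eq_matI)
  fix i j assume ij: "i < dim_row (1\<^sub>m n :: complex mat)" "j < dim_col (1\<^sub>m n :: complex mat)"
  then have i: "i < n" and j: "j < n" by auto
  define r where "r = (\<lambda>j. sqrt (Re (ws ! j \<bullet>c ws ! j)))"
  have c: "ws ! l \<in> carrier_vec n" if "l < n" for l using ws that by auto
  have r: "complex_of_real (r l) * complex_of_real (r l) = ws ! l \<bullet>c ws ! l" if "l < n" for l
  proof -
    have "Re (ws ! l \<bullet>c ws ! l) \<ge> 0"
      unfolding cscalar_prod_self[OF c[OF that]] by (simp add: sum_nonneg)
    then have "complex_of_real (r l) * complex_of_real (r l) = complex_of_real (Re (ws ! l \<bullet>c ws ! l))"
      unfolding r_def of_real_mult[symmetric] by simp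
    also have "\<dots> = ws ! l \<bullet>c ws ! l"
      unfolding cscalar_prod_self[OF c[OF that]] by simp
    finally show ?thesis .
  qed
  have "(U\<^sup>H * U) $$ (i, j)
      = (\<Sum>l<n. cnj (ws ! i $ l) / complex_of_real (r i) * (ws ! j $ l / complex_of_real (r j)))"
    using i j by (simp add: U_def scalar_prod_def lessThan_atLeast0 r_def)
  also have "\<dots> = (ws ! j \<bullet>c ws ! i) / (complex_of_real (r i) * complex_of_real (r j))"
    using c[OF i] c[OF j]
    by (simp add: scalar_prod_def lessThan_atLeast0 sum_divide_distrib mult.commute)
  also have "\<dots> = (if i = j then 1 else 0)"
    using corthogonalD[OF ws(2), of j i] i j ws(3) r[OF i] by (auto simp del: of_real_mult)
  finally show "(U\<^sup>H * U) $$ (i, j) = 1\<^sub>m n $$ (i, j)" using i j by simp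
qed (simp_all add: U_def)

text \<open>The deflation step of the spectral theorem. Column 0 of \<open>U\<close> is a normalized
  eigenvector, so column 0 of \<open>A * U\<close> is \<open>e\<close> times column 0 of
  \<open>U\<close>, and \<open>U\<^sup>H\<close> sends the latter to the first unit vector.\<close>

lemma unitary_first_column_eigenvector:
  fixes A :: "complex mat"
  assumes A: "A \<in> carrier_mat (Suc k) (Suc k)"
  obtains U e where "U \<in> carrier_mat (Suc k) (Suc k)" "U\<^sup>H * U = 1\<^sub>m (Suc k)"
    "\<And>i. i < Suc k \<Longrightarrow> (U\<^sup>H * (A * U)) $$ (i, 0) = (if i = 0 then e else 0)"
proof -
  let ?n = "Suc k"
  obtain e where "eigenvalue A e"
    using spectrum_non_empty[OF A] by (auto simp: spectrum_def)
  then obtain v where v: "v \<in> carrier_vec ?n" "v \<noteq> 0\<^sub>v ?n" and ev: "A *\<^sub>v v = e \<cdot>\<^sub>v v"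
    using A by (auto simp: eigenvalue_def eigenvector_def)
  interpret cof_vec_space ?n "TYPE(complex)" .
  define ws where "ws = gram_schmidt ?n (basis_completion v)"
  note b = basis_completion[OF v]
  from b(6,7) obtain vs where bv: "basis_completion v = v # vs"
    by (cases "basis_completion v") auto
  have ws: "set ws \<subseteq> carrier_vec ?n" "corthogonal ws" "length ws = ?n"
    using gram_schmidt_result[OF b(2) b(4) b(5) refl, folded ws_def] b(6) by auto
  \<comment> \<open>Gram-Schmidt leaves the first vector unchanged, so the eigenvector survives
    orthogonalization.\<close>
  have hd: "ws ! 0 = v"
    using gram_schmidt_hd[OF v(1), of vs] ws(3) unfolding bv[symmetric] ws_def[symmetric]
    by (cases ws) auto
  define c where "c = complex_of_real (sqrt (Re (v \<bullet>c v)))"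
  define U where "U = mat ?n ?n (\<lambda>(i, j). ws ! j $ i / complex_of_real (sqrt (Re (ws ! j \<bullet>c ws ! j))))"
  have U: "U \<in> carrier_mat ?n ?n" by (simp add: U_def)
  have UU: "U\<^sup>H * U = 1\<^sub>m ?n" unfolding U_def by (rule normalize_corthogonal[OF ws])
  have AU: "(A * U) $$ (i, 0) = e * U $$ (i, 0)" if "i < ?n" for i
  proof -
    have "(A * U) $$ (i, 0) = (\<Sum>l<?n. A $$ (i, l) * (v $ l / c))"
      using that A U by (simp add: scalar_prod_def lessThan_atLeast0 U_def hd c_def del: sum.op_ivl_Suc sum.lessThan_Suc)
    also have "\<dots> = (A *\<^sub>v v) $ i / c"
      using that A v(1) by (simp add: scalar_prod_def lessThan_atLeast0 sum_divide_distrib del: sum.op_ivl_Suc sum.lessThan_Suc)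
    also have "\<dots> = e * U $$ (i, 0)"
      unfolding ev using that v(1) by (simp add: U_def hd c_def)
    finally show ?thesis .
  qed
  have "(U\<^sup>H * (A * U)) $$ (i, 0) = (if i = 0 then e else 0)" if i: "i < ?n" for i
  proof -
    have "(U\<^sup>H * (A * U)) $$ (i, 0) = (\<Sum>l<?n. U\<^sup>H $$ (i, l) * (A * U) $$ (l, 0))"
      using i A U by (simp add: scalar_prod_def lessThan_atLeast0 del: sum.op_ivl_Suc sum.lessThan_Suc)
    also have "\<dots> = (\<Sum>l<?n. e * (U\<^sup>H $$ (i, l) * U $$ (l, 0)))"
      by (rule sum.cong) (simp_all only: AU lessThan_iff mult.left_commute)
    also have "\<dots> = e * (U\<^sup>H * U) $$ (i, 0)"
      using i U by (simp add: scalar_prod_def lessThan_atLeast0 sum_distrib_left del: sum.op_ivl_Suc sum.lessThan_Suc)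
    also have "\<dots> = (if i = 0 then e else 0)"
      unfolding UU using i by simp
    finally show ?thesis .
  qed
  with that U UU show ?thesis by blast
qed

lemma unitary_left_inverse:
  "U \<in> carrier_mat n n \<Longrightarrow> U\<^sup>H * U = 1\<^sub>m n \<Longrightarrow> U * U\<^sup>H = (1\<^sub>m n :: complex mat)"
  by (rule mat_mult_left_right_inverse) auto

text \<open>Induction on the dimension: deflation by one eigenvector leaves a Hermitian trailing
  block of size \<open>k\<close>, to which the induction hypothesis applies.\<close>

lemma hermitian_diagonalization:
  fixes A :: "complex mat"
  assumes "A \<in> carrier_mat n n" "A\<^sup>H = A"
  shows "\<exists>U d. U \<in> carrier_mat n n \<and> U\<^sup>H * U = 1\<^sub>m n \<and>
    A = U * mat_diag n (\<lambda>i. complex_of_real (d i)) * U\<^sup>H"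
  using assms
proof (induction n arbitrary: A)
  case 0
  show ?case
    by (rule exI[of _ "1\<^sub>m 0"], rule exI) (use 0 in \<open>auto intro!: eq_matI\<close>)
next
  case (Suc k A)
  let ?n = "Suc k"
  from unitary_first_column_eigenvector[OF Suc.prems(1)] obtain U e where
    U: "U \<in> carrier_mat ?n ?n" and UU: "U\<^sup>H * U = 1\<^sub>m ?n" and
    col0: "\<And>i. i < ?n \<Longrightarrow> (U\<^sup>H * (A * U)) $$ (i, 0) = (if i = 0 then e else 0)" by metis
  note UU' = unitary_left_inverse[OF U UU]
  define M where "M = U\<^sup>H * (A * U)"
  have A: "dim_row A = ?n" "dim_col A = ?n" and U': "dim_row U = ?n" "dim_col U = ?n"
    using Suc.prems U by auto
  have M: "M \<in> carrier_mat ?n ?n" by (rule carrier_matI) (simp_all add: M_def U')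
  have MH: "M\<^sup>H = M"
    by (simp add: M_def mat_ring_simps A U' Suc.prems(2))
  have MM: "M $$ (i, j) = cnj (M $$ (j, i))" if "i < ?n" "j < ?n" for i j
    by (subst MH[symmetric], subst index_mat_adjoint) (use M that in auto)
  note col0 = col0[folded M_def]
  \<comment> \<open>Hermitian symmetry clears the first row along with the first column, so
    \<open>M\<close> is block diagonal and not merely block triangular.\<close>
  have row0: "M $$ (0, j) = (if j = 0 then e else 0)" if "j < ?n" for j
    using MM[of 0 j] MM[of 0 0] col0 that by auto
  have e: "complex_of_real (Re e) = e"
    using MM[of 0 0] col0[of 0] by (simp add: complex_eq_iff)
  define N where "N = mat k k (\<lambda>(i, j). M $$ (Suc i, Suc j))"
  have N: "N \<in> carrier_mat k k" "N\<^sup>H = N"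
    by (auto simp: N_def intro!: eq_matI) (metis MM Suc_less_eq complex_cnj_cnj)
  from Suc.IH[OF N] obtain V d where V: "V \<in> carrier_mat k k" "V\<^sup>H * V = 1\<^sub>m k"
    and NV: "N = V * mat_diag k (\<lambda>i. complex_of_real (d i)) * V\<^sup>H" by auto
  have M_block: "M = four_block_mat (mat 1 1 (\<lambda>_. e)) (0\<^sub>m 1 k) (0\<^sub>m k 1) N"
    by (rule eq_matI) (use M row0 col0 in \<open>auto simp: N_def\<close>)
  \<comment> \<open>Extends the unitary matrix of the trailing block by a fixed first coordinate;
    \<open>U * W\<close> then diagonalizes \<open>A\<close>.\<close>
  define W where "W = four_block_mat (1\<^sub>m 1) (0\<^sub>m 1 k) (0\<^sub>m k 1) V"
  define d' where "d' = (\<lambda>i. case i of 0 \<Rightarrow> Re e | Suc j \<Rightarrow> d j)"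
  have d': "(\<lambda>i. complex_of_real (d' i))
      = (\<lambda>i. case i of 0 \<Rightarrow> e | Suc j \<Rightarrow> complex_of_real (d j))"
    by (auto simp: d'_def e split: nat.splits)
  have W: "W \<in> carrier_mat ?n ?n" unfolding W_def using V by auto
  have WH: "W\<^sup>H = four_block_mat (1\<^sub>m 1) (0\<^sub>m 1 k) (0\<^sub>m k 1) (V\<^sup>H)"
    unfolding W_def using V by (subst mat_adjoint_four_block) auto
  have WW: "W\<^sup>H * W = 1\<^sub>m ?n"
    unfolding WH unfolding W_def
    using V by (simp add: mult_block_diag)
  have "W * mat_diag ?n (\<lambda>i. complex_of_real (d' i)) * W\<^sup>H = M"
    unfolding d' mat_diag_Suc_block WH unfolding W_def M_block NV
    using V
    by (simp add: mult_block_diag mat_mult_one)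
  moreover have "A = U * M * U\<^sup>H"
    by (simp add: M_def mat_ring_simps A U' UU' mat_inverse_cancel[OF UU'])
  ultimately have "A = (U * W) * mat_diag ?n (\<lambda>i. complex_of_real (d' i)) * (U * W)\<^sup>H"
    using W U' by (auto simp: mat_ring_simps)
  moreover have "(U * W)\<^sup>H * (U * W) = 1\<^sub>m ?n"
    using W U' WW by (auto simp: mat_ring_simps mat_inverse_cancel[OF UU])
  ultimately show ?case using U W by (metis mult_carrier_mat)
qed

section \<open>Positive definite matrices\<close>

lemma positive_definite_iff:
  assumes "M \<in> carrier_mat n n"
  shows "positive_definite M \<longleftrightarrow>
    M\<^sup>H = M \<and> (\<forall>v \<in> carrier_vec n. v \<noteq> 0\<^sub>v n \<longrightarrow> 0 < Re ((M *\<^sub>v v) \<bullet>c v))"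
  using assms by (auto simp: positive_definite_def)

text \<open>The left inverse makes \<open>K\<close> injective, so \<open>K v\<close> is nonzero and
  can be tested against \<open>M\<close>. A rectangular \<open>K\<close> is allowed so that passing
  to a diagonal block is also an instance.\<close>

lemma positive_definite_congruence:
  assumes pd: "positive_definite M" and M: "M \<in> carrier_mat n n" and K: "K \<in> carrier_mat n k"
    and L: "L \<in> carrier_mat k n" "L * K = 1\<^sub>m k"
  shows "positive_definite (K\<^sup>H * M * K)"
proof -
  have c: "K\<^sup>H * M * K \<in> carrier_mat k k" using M K by (metis mat_adjoint_carrier mult_carrier_mat)
  have "M\<^sup>H = M" using pd M by (simp add: positive_definite_iff)
  then have "(K\<^sup>H * M * K)\<^sup>H = K\<^sup>H * M * K"
    using carrier_matD[OF M] carrier_matD[OF K] by (simp add: mat_adjoint_mult mat_mult_assoc)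
  moreover have "0 < Re ((K\<^sup>H * M * K *\<^sub>v v) \<bullet>c v)" if v: "v \<in> carrier_vec k" "v \<noteq> 0\<^sub>v k" for v
  proof -
    have Kv: "K *\<^sub>v v \<in> carrier_vec n" using K v by auto
    have "L *\<^sub>v (K *\<^sub>v v) = v"
      using assoc_mult_mat_vec[OF L(1) K v(1)] L(2) v by simp
    moreover have "L *\<^sub>v 0\<^sub>v n = 0\<^sub>v k"
      using L(1) by (intro eq_vecI) auto
    ultimately have "K *\<^sub>v v \<noteq> 0\<^sub>v n"
      using v by auto
    then have "0 < Re ((M *\<^sub>v (K *\<^sub>v v)) \<bullet>c (K *\<^sub>v v))"
      using pd M Kv by (simp add: positive_definite_iff)
    also have "K\<^sup>H * M * K *\<^sub>v v = K\<^sup>H *\<^sub>v (M *\<^sub>v (K *\<^sub>v v))"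
    proof -
      have KH: "K\<^sup>H \<in> carrier_mat k n" using K by simp
      show ?thesis
        unfolding assoc_mult_mat_vec[OF mult_carrier_mat[OF KH M] K v(1)]
        by (rule assoc_mult_mat_vec[OF KH M Kv])
    qed
    then have "(M *\<^sub>v (K *\<^sub>v v)) \<bullet>c (K *\<^sub>v v) = (K\<^sup>H * M * K *\<^sub>v v) \<bullet>c v"
      using cscalar_prod_adjoint[of "K\<^sup>H" k n "M *\<^sub>v (K *\<^sub>v v)" v] K M v by simp
    finally show ?thesis .
  qed
  ultimately show ?thesis using c by (simp add: positive_definite_iff)
qed

text \<open>The quadratic form is the sum of the \<open>d i\<close> weighted by the squared moduli
  of the coordinates, and unit vectors isolate a single \<open>d i\<close>.\<close>

lemma positive_definite_mat_diag:
  "positive_definite (mat_diag n (\<lambda>i. complex_of_real (d i))) \<longleftrightarrow> (\<forall>i<n. 0 < d i)"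
proof -
  let ?D = "mat_diag n (\<lambda>i. complex_of_real (d i))"
  have q: "Re ((?D *\<^sub>v v) \<bullet>c v) = (\<Sum>i<n. d i * (cmod (v $ i))\<^sup>2)" if v: "v \<in> carrier_vec n" for v
  proof -
    have "(?D *\<^sub>v v) $ i = complex_of_real (d i) * v $ i" if "i < n" for i
    proof -
      have "(?D *\<^sub>v v) $ i = (\<Sum>j<n. (if i = j then complex_of_real (d j) else 0) * v $ j)"
        using v that by (simp add: mat_diag_def scalar_prod_def lessThan_atLeast0)
      also have "\<dots> = (\<Sum>j<n. if j = i then complex_of_real (d i) * v $ i else 0)"
        by (rule sum.cong) auto
      finally show ?thesis using that by simp
    qed
    then have "(?D *\<^sub>v v) \<bullet>c v = (\<Sum>i<n. complex_of_real (d i) * (v $ i * cnj (v $ i)))"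
      using v by (simp add: scalar_prod_def lessThan_atLeast0 mult.assoc)
    also have "\<dots> = complex_of_real (\<Sum>i<n. d i * (cmod (v $ i))\<^sup>2)"
      by (simp only: complex_norm_square of_real_sum of_real_mult)
    finally show ?thesis by simp
  qed
  show ?thesis
  proof
    assume pd: "positive_definite ?D"
    show "\<forall>i<n. 0 < d i"
    proof (intro allI impI)
      fix i assume i: "i < n"
      have "unit_vec n i \<noteq> (0\<^sub>v n :: complex vec)"
      proof
        assume "unit_vec n i = (0\<^sub>v n :: complex vec)"
        from arg_cong[OF this, of "\<lambda>v. v $ i"] i show False by simp
      qed
      then have "0 < Re ((?D *\<^sub>v unit_vec n i) \<bullet>c unit_vec n i)"
        using pd by (simp add: positive_definite_iff[of _ n])
      also have "\<dots> = (\<Sum>j<n. if j = i then d i else 0)"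
        unfolding q[OF unit_vec_carrier] by (rule sum.cong) (use i in auto)
      finally show "0 < d i" using i by simp
    qed
  next
    assume d: "\<forall>i<n. 0 < d i"
    have "0 < (\<Sum>i<n. d i * (cmod (v $ i))\<^sup>2)" if v: "v \<in> carrier_vec n" "v \<noteq> 0\<^sub>v n" for v
    proof -
      obtain i where i: "i < n" "v $ i \<noteq> 0"
        using v by (metis carrier_vecD eq_vecI index_zero_vec)
      show ?thesis
        by (rule sum_pos2[of _ i]) (use i d in \<open>auto intro: less_imp_le\<close>)
    qed
    then show "positive_definite ?D"
      by (simp add: positive_definite_iff[of _ n] q)
  qed
qed

lemma positive_definite_diagonalization:
  assumes "positive_definite M" and M: "M \<in> carrier_mat n n"
  obtains U d where "U \<in> carrier_mat n n" "U\<^sup>H * U = 1\<^sub>m n" "U * U\<^sup>H = 1\<^sub>m n" "\<And>i. i < n \<Longrightarrow> 0 < d i"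
    "M = U * mat_diag n (\<lambda>i. complex_of_real (d i)) * U\<^sup>H"
proof -
  have "M\<^sup>H = M" using assms by (simp add: positive_definite_iff)
  from hermitian_diagonalization[OF M this] obtain U d where U: "U \<in> carrier_mat n n" "U\<^sup>H * U = 1\<^sub>m n"
    and MU: "M = U * mat_diag n (\<lambda>i. complex_of_real (d i)) * U\<^sup>H" by auto
  have "U\<^sup>H * M * U = mat_diag n (\<lambda>i. complex_of_real (d i))"
    unfolding MU using carrier_matD[OF U(1)]
    by (simp add: mat_mult_assoc U(2) mat_inverse_cancel[OF U(2)] mat_mult_one)
  with positive_definite_congruence[OF assms U(1) _ U(2)] U(1)
  have "\<And>i. i < n \<Longrightarrow> 0 < d i" by (simp add: positive_definite_mat_diag)
  with that[OF U unitary_left_inverse[OF U]] MU show ?thesis by blast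
qed

section \<open>Positive definite square roots\<close>

lemma positive_definite_sqrt_exists:
  assumes "positive_definite M" "M \<in> carrier_mat n n"
  shows "\<exists>Q. Q \<in> carrier_mat n n \<and> positive_definite Q \<and> Q * Q = M"
proof -
  from positive_definite_diagonalization[OF assms] obtain U d where
    U: "U \<in> carrier_mat n n" "U\<^sup>H * U = 1\<^sub>m n" "U * U\<^sup>H = 1\<^sub>m n" and d: "\<And>i. i < n \<Longrightarrow> 0 < d i"
    and M: "M = U * mat_diag n (\<lambda>i. complex_of_real (d i)) * U\<^sup>H" by metis
  define E where "E = mat_diag n (\<lambda>i. complex_of_real (sqrt (d i)))"
  have E: "dim_row E = n" "dim_col E = n" by (simp_all add: E_def)
  have EE: "E * E = mat_diag n (\<lambda>i. complex_of_real (d i))"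
    unfolding E_def mat_diag_diag
    by (rule eq_matI) (auto simp: mat_diag_def simp flip: of_real_mult dest!: d)
  \<comment> \<open>The doubled adjoint matches the shape of the congruence lemma with
    \<open>K = U\<^sup>H\<close>, whose left inverse is \<open>U\<close>.\<close>
  define Q where "Q = (U\<^sup>H)\<^sup>H * E * U\<^sup>H"
  have "positive_definite E"
    unfolding E_def positive_definite_mat_diag using d by simp
  then have "positive_definite Q"
    unfolding Q_def by (rule positive_definite_congruence[of _ n _ _ U]) (use U E in auto)
  moreover have "Q * Q = M"
    using carrier_matD[OF U(1)] E unfolding M EE[symmetric]
    by (simp add: Q_def mat_mult_assoc mat_inverse_cancel[OF U(2)])
  moreover have "Q \<in> carrier_mat n n"
    using U E by (auto simp: Q_def)
  ultimately show ?thesis by blast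
qed

text \<open>The diagonal entries of the product are the values of the quadratic form of
  \<open>S\<close> at the columns of \<open>E\<close>; nonnegative numbers with sum zero all
  vanish.\<close>

lemma positive_definite_trace_adjoint_mult_eq_0:
  assumes pd: "positive_definite S" and S: "S \<in> carrier_mat n n" and E: "E \<in> carrier_mat n k"
    and tr: "mat_trace (E\<^sup>H * S * E) = 0"
  shows "E = 0\<^sub>m n k"
proof -
  have entry: "(E\<^sup>H * S * E) $$ (j, j) = (S *\<^sub>v col E j) \<bullet>c col E j" if "j < k" for j
  proof -
    have "(E\<^sup>H * S * E) $$ (j, j) = (E\<^sup>H * (S * E)) $$ (j, j)"
      using S E by (simp add: mat_mult_assoc)
    also have "\<dots> = (\<Sum>l<n. cnj (E $$ (l, j)) * (S * E) $$ (l, j))"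
      using that S E by (simp add: scalar_prod_def lessThan_atLeast0)
    also have "\<dots> = (\<Sum>l<n. (S *\<^sub>v col E j) $ l * cnj (col E j $ l))"
      by (rule sum.cong) (use that S E in auto)
    also have "\<dots> = (S *\<^sub>v col E j) \<bullet>c col E j"
      using that E by (simp add: scalar_prod_def lessThan_atLeast0)
    finally show ?thesis .
  qed
  have pos: "0 < Re ((S *\<^sub>v col E j) \<bullet>c col E j)" if "j < k" "col E j \<noteq> 0\<^sub>v n" for j
    using pd S E that by (auto simp: positive_definite_iff[OF S])
  have nonneg: "0 \<le> Re ((S *\<^sub>v col E j) \<bullet>c col E j)" if "j < k" for j
    using pos[OF that] S E by (cases "col E j = 0\<^sub>v n") auto
  have "(\<Sum>j<k. Re ((S *\<^sub>v col E j) \<bullet>c col E j)) = 0"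
  proof -
    have "mat_trace (E\<^sup>H * S * E) = (\<Sum>j<k. (S *\<^sub>v col E j) \<bullet>c col E j)"
      unfolding mat_trace_def index_mult_mat dim_mat_adjoint carrier_matD[OF E]
      by (rule sum.cong) (simp_all only: entry lessThan_iff)
    with tr show ?thesis by (metis Re_sum zero_complex.simps(1))
  qed
  then have "\<forall>j<k. Re ((S *\<^sub>v col E j) \<bullet>c col E j) = 0"
    by (subst (asm) sum_nonneg_eq_0_iff) (use nonneg in auto)
  then have col0: "col E j = 0\<^sub>v n" if "j < k" for j
    using pos that by force
  show ?thesis
  proof (rule eq_matI)
    fix i j assume "i < dim_row (0\<^sub>m n k :: complex mat)" "j < dim_col (0\<^sub>m n k :: complex mat)"
    then show "E $$ (i, j) = 0\<^sub>m n k $$ (i, j)"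
      using E arg_cong[OF col0, of j "\<lambda>v. v $ i"] by auto
  qed (use E in auto)
qed

lemma positive_definite_add:
  assumes "positive_definite M" "positive_definite N" "M \<in> carrier_mat n n" "N \<in> carrier_mat n n"
  shows "positive_definite (M + N)"
proof -
  have "((M + N) *\<^sub>v v) \<bullet>c v = (M *\<^sub>v v) \<bullet>c v + (N *\<^sub>v v) \<bullet>c v" if "v \<in> carrier_vec n" for v
  proof -
    have "(M + N) *\<^sub>v v = M *\<^sub>v v + N *\<^sub>v v"
      by (rule add_mult_distrib_mat_vec) (use assms that in auto)
    moreover have "(M *\<^sub>v v + N *\<^sub>v v) \<bullet>c v = (M *\<^sub>v v) \<bullet>c v + (N *\<^sub>v v) \<bullet>c v"
      by (rule add_scalar_prod_distrib[of _ n]) (use assms that in auto)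
    ultimately show ?thesis by simp
  qed
  with assms show ?thesis
    by (simp add: positive_definite_iff[of _ n] mat_adjoint_add add_pos_pos)
qed

text \<open>With \<open>E = Q - Q'\<close>, \<open>Q\<^sup>2 = Q'\<^sup>2\<close> says \<open>Q E = - E Q'\<close>, so \<open>E Q E\<close> and \<open>E Q' E\<close> have opposite
  traces.\<close>
lemma positive_definite_sqrt_unique:
  assumes "positive_definite Q" "positive_definite Q'" "Q \<in> carrier_mat n n" "Q' \<in> carrier_mat n n"
    and eq: "Q * Q = Q' * Q'"
  shows "Q = Q'"
proof -
  define E where "E = Q - Q'"
  have d: "dim_row Q = n" "dim_col Q = n" "dim_row Q' = n" "dim_col Q' = n" "dim_row E = n" "dim_col E = n"
    using assms by (auto simp: E_def)
  have c: "E \<in> carrier_mat n n" "Q * E \<in> carrier_mat n n" "E * Q' \<in> carrier_mat n n"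
    "E * (Q * E) \<in> carrier_mat n n" "E * (Q' * E) \<in> carrier_mat n n"
    "E * (E * Q') \<in> carrier_mat n n"
    by (auto intro!: carrier_matI simp: d)
  have H: "Q\<^sup>H = Q" "Q'\<^sup>H = Q'" using assms by (simp_all add: positive_definite_iff[of _ n])
  have EH: "E\<^sup>H = E" unfolding E_def by (simp only: mat_ring_simps d(1-4) H)
  have QE: "Q * E = - (E * Q')"
    unfolding E_def by (simp only: mat_ring_simps d(1-4) eq)
  have "mat_trace (E * (Q * E)) = - mat_trace (E * (E * Q'))"
    unfolding QE by (simp only: mat_ring_simps d mat_trace_uminus[OF c(6)])
  also have "mat_trace (E * (E * Q')) = mat_trace ((E * Q') * E)"
    by (rule mat_trace_mult_commute[OF c(1,3)])
  also have "(E * Q') * E = E * (Q' * E)"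
    using d by (simp add: mat_mult_assoc)
  finally have tr: "mat_trace (E\<^sup>H * (Q + Q') * E) = 0"
    by (simp only: EH mat_ring_simps d mat_trace_add[OF c(4,5)] add.left_inverse)
  have "E = 0\<^sub>m n n"
    by (rule positive_definite_trace_adjoint_mult_eq_0[OF positive_definite_add[OF assms(1-4)] _ c(1) tr])
      (use assms in auto)
  then have "E $$ (i, j) = 0" if "i < n" "j < n" for i j using that by simp
  then show ?thesis by (intro eq_matI) (auto simp: E_def d)
qed

lemma pd_sqrt:
  assumes "positive_definite M" "M \<in> carrier_mat n n"
  shows "pd_sqrt M \<in> carrier_mat n n" "positive_definite (pd_sqrt M)" "pd_sqrt M * pd_sqrt M = M"
proof -
  from positive_definite_sqrt_exists[OF assms] obtain Q where
    Q: "Q \<in> carrier_mat n n" "positive_definite Q" "Q * Q = M" by blast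
  have "pd_sqrt M = Q"
    unfolding pd_sqrt_def
  proof (rule the_equality)
    \<comment> \<open>The description in \<open>pd_sqrt\<close> does not fix the size of the root;
      it is recovered from squareness and from the number of rows of \<open>Q' * Q'\<close>.\<close>
    fix Q' assume Q': "positive_definite Q' \<and> Q' * Q' = M"
    then have "square_mat Q'" by (simp add: positive_definite_def)
    moreover have "dim_row Q' = n" using Q' assms(2) by (metis carrier_matD(1) index_mult_mat(2))
    ultimately have "Q' \<in> carrier_mat n n" by (metis carrier_matI square_mat.elims(2))
    with Q Q' positive_definite_sqrt_unique show "Q' = Q" by metis
  qed (use Q in simp)
  with Q show "pd_sqrt M \<in> carrier_mat n n" "positive_definite (pd_sqrt M)" "pd_sqrt M * pd_sqrt M = M"
    by simp_all
qed

section \<open>Inverses, factorizations and determinants\<close>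

lemma mat_inv_eqI:
  assumes M: "M \<in> carrier_mat n n" and N: "N \<in> carrier_mat n n" and MN: "M * N = 1\<^sub>m n"
  shows "mat_inv M = N"
proof (cases "mat_inverse M")
  case None
  have "det M * det N = 1"
    using det_mult[OF M N] MN by simp
  then have "det M \<noteq> 0" by auto
  \<comment> \<open>A nonzero determinant makes \<open>M\<close> a unit, while failure of the
    elimination says that it is none. \<open>undefined\<close> fills the extension slot of the
    matrix ring, which only has to agree in both facts.\<close>
  from det_non_zero_imp_unit[OF M this, of undefined] mat_inverse(1)[OF M None, of undefined]
  show ?thesis by blast
next
  case (Some B)
  from mat_inverse(2)[OF M this] have B: "B * M = 1\<^sub>m n" "B \<in> carrier_mat n n" by auto
  have "B = B * (M * N)" using B MN by simp
  also have "\<dots> = N" using M N B by (metis assoc_mult_mat left_mult_one_mat)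
  finally show ?thesis by (simp add: mat_inv_def Some)
qed

text \<open>\<open>Z\<close> is the unitary factor times the square roots of the eigenvalues. Its
  explicit inverse \<open>Y\<close> serves for inverting \<open>M\<close> and for undoing
  congruences.\<close>

lemma positive_definite_factorization:
  assumes "positive_definite M" "M \<in> carrier_mat n n"
  obtains Z Y where "Z \<in> carrier_mat n n" "Y \<in> carrier_mat n n" "Z * Y = 1\<^sub>m n" "Y * Z = 1\<^sub>m n" "M = Z * Z\<^sup>H"
proof -
  from positive_definite_diagonalization[OF assms] obtain U d where
    U: "U \<in> carrier_mat n n" "U\<^sup>H * U = 1\<^sub>m n" "U * U\<^sup>H = 1\<^sub>m n" and d: "\<And>i. i < n \<Longrightarrow> 0 < d i"
    and M: "M = U * mat_diag n (\<lambda>i. complex_of_real (d i)) * U\<^sup>H" by metis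
  define E where "E = mat_diag n (\<lambda>i. complex_of_real (sqrt (d i)))"
  define F where "F = mat_diag n (\<lambda>i. complex_of_real (1 / sqrt (d i)))"
  have dim: "dim_row E = n" "dim_col E = n" "dim_row F = n" "dim_col F = n"
    "dim_row U = n" "dim_col U = n" using U by (auto simp: E_def F_def)
  have EH: "E\<^sup>H = E" by (simp add: E_def)
  have EE: "E * E = mat_diag n (\<lambda>i. complex_of_real (d i))"
    unfolding E_def mat_diag_diag
    by (rule eq_matI) (auto simp: mat_diag_def simp flip: of_real_mult dest!: d)
  have EF: "E * F = 1\<^sub>m n"
    unfolding E_def F_def mat_diag_diag
    by (rule eq_matI) (auto simp: mat_diag_def simp flip: of_real_mult dest!: d)
  have UEF: "(U * E) * (F * U\<^sup>H) = 1\<^sub>m n"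
    using dim by (simp add: mat_mult_assoc mat_inverse_cancel[OF EF] U(3))
  have c: "U * E \<in> carrier_mat n n" "F * U\<^sup>H \<in> carrier_mat n n"
    by (auto intro!: carrier_matI simp: dim)
  have "M = (U * E) * (U * E)\<^sup>H"
    using dim unfolding M EE[symmetric] by (simp add: mat_mult_assoc mat_adjoint_mult EH)
  with that[OF c UEF mat_mult_left_right_inverse[OF c UEF]] show ?thesis by blast
qed

text \<open>From \<open>M = Z * Z\<^sup>H\<close> the inverse is \<open>Y\<^sup>H * Y\<close>, which
  is visibly Hermitian.\<close>

lemma positive_definite_mat_inv:
  assumes "positive_definite M" "M \<in> carrier_mat n n"
  shows "mat_inv M \<in> carrier_mat n n" "M * mat_inv M = 1\<^sub>m n" "mat_inv M * M = 1\<^sub>m n"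
    "(mat_inv M)\<^sup>H = mat_inv M"
proof -
  from positive_definite_factorization[OF assms] obtain Z Y where
    Z: "Z \<in> carrier_mat n n" "Y \<in> carrier_mat n n" "Z * Y = 1\<^sub>m n" "Y * Z = 1\<^sub>m n" "M = Z * Z\<^sup>H"
    by metis
  have dim: "dim_row Z = n" "dim_col Z = n" "dim_row Y = n" "dim_col Y = n" using Z by auto
  have "Z\<^sup>H * Y\<^sup>H = 1\<^sub>m n"
    using arg_cong[OF Z(4), of mat_adjoint] dim by (simp add: mat_adjoint_mult)
  then have MN: "M * (Y\<^sup>H * Y) = 1\<^sub>m n"
    using dim by (simp add: Z(5) mat_mult_assoc mat_inverse_cancel[OF \<open>Z\<^sup>H * Y\<^sup>H = 1\<^sub>m n\<close>] Z(3))
  have c: "Y\<^sup>H * Y \<in> carrier_mat n n" by (auto intro!: carrier_matI simp: dim)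
  note inv = mat_inv_eqI[OF assms(2) c MN]
  show "mat_inv M \<in> carrier_mat n n" "M * mat_inv M = 1\<^sub>m n" "mat_inv M * M = 1\<^sub>m n"
    "(mat_inv M)\<^sup>H = mat_inv M"
    unfolding inv using c MN mat_mult_left_right_inverse[OF assms(2) c MN] dim
    by (simp_all add: mat_adjoint_mult)
qed

lemma det_mat_diag: "det (mat_diag n f) = (\<Prod>i<n. f i)" for f :: "nat \<Rightarrow> complex"
proof -
  have "det (mat_diag n f) = prod_list (diag_mat (mat_diag n f))"
    by (rule det_upper_triangular[of _ n]) (auto simp: mat_diag_def)
  also have "\<dots> = (\<Prod>i<n. f i)"
    by (simp add: diag_mat_def mat_diag_def prod.list_conv_set_nth lessThan_atLeast0)
  finally show ?thesis .
qed

lemma positive_definite_det: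
  assumes "positive_definite M" "M \<in> carrier_mat n n"
  shows "Im (det M) = 0" "0 < Re (det M)"
proof -
  from positive_definite_diagonalization[OF assms] obtain U d where
    U: "U \<in> carrier_mat n n" "U\<^sup>H * U = 1\<^sub>m n" "U * U\<^sup>H = 1\<^sub>m n" and d: "\<And>i. i < n \<Longrightarrow> 0 < d i"
    and M: "M = U * mat_diag n (\<lambda>i. complex_of_real (d i)) * U\<^sup>H" by metis
  have "det M = det U * det (mat_diag n (\<lambda>i. complex_of_real (d i))) * det (U\<^sup>H)"
    unfolding M using U(1) det_mult[of "U * mat_diag n (\<lambda>i. complex_of_real (d i))" n "U\<^sup>H"]
      det_mult[of U n "mat_diag n (\<lambda>i. complex_of_real (d i))"] by simp
  moreover have "det U * det (U\<^sup>H) = 1"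
    using U by (subst det_mult[of _ n, symmetric]) auto
  ultimately have "det M = (\<Prod>i<n. complex_of_real (d i))"
    by (simp add: det_mat_diag mult.commute)
  then have "det M = complex_of_real (\<Prod>i<n. d i)" by simp
  moreover have "0 < (\<Prod>i<n. d i)" using d by (intro prod_pos) auto
  ultimately show "Im (det M) = 0" "0 < Re (det M)"
    by (simp_all only: Im_complex_of_real Re_complex_of_real)
qed

section \<open>Determinants along Hermitian pencils\<close>

text \<open>After factoring \<open>M\<close>, the matrix \<open>Y * N * Y\<^sup>H\<close> is
  Hermitian and has a unitary diagonalization \<open>U\<close>. Replacing \<open>Z\<close> by
  \<open>Z * U\<close> diagonalizes \<open>N\<close> and does not change
  \<open>Z * Z\<^sup>H\<close>.\<close>

lemma simultaneous_diagonalization: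
  assumes pd: "positive_definite M" and M: "M \<in> carrier_mat n n"
    and N: "N \<in> carrier_mat n n" "N\<^sup>H = N"
  obtains Z Y d where "Z \<in> carrier_mat n n" "Y \<in> carrier_mat n n" "Z * Y = 1\<^sub>m n" "Y * Z = 1\<^sub>m n"
    "M = Z * Z\<^sup>H" "N = Z * mat_diag n (\<lambda>i. complex_of_real (d i)) * Z\<^sup>H"
proof -
  from positive_definite_factorization[OF pd M] obtain Z Y where
    Z: "Z \<in> carrier_mat n n" "Y \<in> carrier_mat n n" "Z * Y = 1\<^sub>m n" "Y * Z = 1\<^sub>m n" "M = Z * Z\<^sup>H"
    by metis
  have YZ: "Y\<^sup>H * Z\<^sup>H = 1\<^sub>m n"
    using arg_cong[OF Z(3), of mat_adjoint] Z(1,2) by (simp add: mat_adjoint_mult)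
  have dim: "dim_row Z = n" "dim_col Z = n" "dim_row Y = n" "dim_col Y = n" "dim_row N = n" "dim_col N = n"
    using Z N by auto
  have "Y * N * Y\<^sup>H \<in> carrier_mat n n" by (rule carrier_matI) (simp_all only: mat_ring_simps dim)
  moreover have "(Y * N * Y\<^sup>H)\<^sup>H = Y * N * Y\<^sup>H" by (simp only: mat_ring_simps dim N)
  ultimately obtain U d where U: "U \<in> carrier_mat n n" "U\<^sup>H * U = 1\<^sub>m n"
    and YNY: "Y * N * Y\<^sup>H = U * mat_diag n (\<lambda>i. complex_of_real (d i)) * U\<^sup>H"
    using hermitian_diagonalization by blast
  note UU = unitary_left_inverse[OF U]
  have dimU: "dim_row U = n" "dim_col U = n" using U by auto
  have "(Z * U) * (U\<^sup>H * Y) = 1\<^sub>m n"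
    by (simp only: mat_ring_simps dim dimU mat_inverse_cancel[OF UU] Z(3))
  moreover have "(U\<^sup>H * Y) * (Z * U) = 1\<^sub>m n"
    by (simp only: mat_ring_simps dim dimU mat_inverse_cancel[OF Z(4)] U(2))
  moreover have "M = (Z * U) * (Z * U)\<^sup>H"
    by (simp only: Z(5) mat_ring_simps dim dimU mat_inverse_cancel[OF UU])
  moreover have "N = (Z * U) * mat_diag n (\<lambda>i. complex_of_real (d i)) * (Z * U)\<^sup>H"
  proof -
    have "N = Z * (Y * N * Y\<^sup>H) * Z\<^sup>H"
      by (simp only: mat_ring_simps dim dimU mat_inverse_cancel[OF Z(3)] YZ)
    also have "\<dots> = (Z * U) * mat_diag n (\<lambda>i. complex_of_real (d i)) * (Z * U)\<^sup>H"
      unfolding YNY by (simp only: mat_ring_simps dim dimU dim_mat_diag)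
    finally show ?thesis .
  qed
  moreover have "Z * U \<in> carrier_mat n n" "U\<^sup>H * Y \<in> carrier_mat n n"
    by (rule carrier_matI; simp only: mat_ring_simps dim dimU)+
  ultimately show ?thesis using that by blast
qed

text \<open>The line \<open>M + t N\<close> with real \<open>t\<close>. It is instantiated with
  \<open>W\<close> and \<open>dW \<Delta>\<close> as well as with \<open>X\<close> and
  \<open>\<Delta>\<close>, one for each constraint of the feasible set.\<close>

locale hermitian_pencil =
  fixes M N :: "complex mat" and n :: nat
  assumes M_pd: "positive_definite M" and M_carrier: "M \<in> carrier_mat n n"
    and N_carrier: "N \<in> carrier_mat n n" and N_hermitian: "N\<^sup>H = N"
begin

text \<open>The \<open>d i\<close> are the eigenvalues of \<open>mat_inv M * N\<close>: the pencil
  is \<open>Z\<close> times the diagonal matrix of the \<open>1 + t * d i\<close> times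
  \<open>Z\<^sup>H\<close>, and the outer factors contribute \<open>det M\<close>. The facts are
  stated jointly because they must share one \<open>d\<close>.\<close>

lemma eigenvalues:
  obtains d where
    "mat_trace (mat_inv M * N) = complex_of_real (\<Sum>i<n. d i)"
    "\<And>t. Re (det (M + complex_of_real t \<cdot>\<^sub>m N)) = Re (det M) * (\<Prod>i<n. 1 + t * d i)"
    "\<And>t. positive_definite (M + complex_of_real t \<cdot>\<^sub>m N) \<longleftrightarrow> (\<forall>i<n. 0 < 1 + t * d i)"
    "(\<forall>i<n. d i = 0) \<Longrightarrow> N = 0\<^sub>m n n"
proof -
  from simultaneous_diagonalization[OF M_pd M_carrier N_carrier N_hermitian] obtain Z Y d where
    Z: "Z \<in> carrier_mat n n" "Y \<in> carrier_mat n n" "Z * Y = 1\<^sub>m n" "Y * Z = 1\<^sub>m n"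
    and M: "M = Z * Z\<^sup>H" and N: "N = Z * mat_diag n (\<lambda>i. complex_of_real (d i)) * Z\<^sup>H"
    by metis
  define D where "D = mat_diag n (\<lambda>i. complex_of_real (d i))"
  define E where "E = (\<lambda>t. mat_diag n (\<lambda>i. complex_of_real (1 + t * d i)))"
  have dim: "dim_row Z = n" "dim_col Z = n" "dim_row Y = n" "dim_col Y = n" "dim_row D = n" "dim_col D = n"
    "dim_row (E t) = n" "dim_col (E t) = n" for t
    using Z by (auto simp: D_def E_def)
  have YZ: "Y\<^sup>H * Z\<^sup>H = 1\<^sub>m n" and ZY: "Z\<^sup>H * Y\<^sup>H = 1\<^sub>m n"
    using arg_cong[OF Z(3), of mat_adjoint] arg_cong[OF Z(4), of mat_adjoint] Z(1,2)
    by (simp_all add: mat_adjoint_mult)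
  have inv: "mat_inv M = Y\<^sup>H * Y"
  proof (rule mat_inv_eqI[OF M_carrier])
    show "Y\<^sup>H * Y \<in> carrier_mat n n" by (rule carrier_matI) (simp_all only: mat_ring_simps dim)
    show "M * (Y\<^sup>H * Y) = 1\<^sub>m n"
      by (simp only: M mat_ring_simps dim mat_inverse_cancel[OF ZY] Z(3))
  qed
  have E: "M + complex_of_real t \<cdot>\<^sub>m N = Z * E t * Z\<^sup>H" for t
  proof -
    have "E t = 1\<^sub>m n + complex_of_real t \<cdot>\<^sub>m D"
      by (rule eq_matI) (auto simp: E_def D_def mat_diag_def)
    then show ?thesis
      by (simp only: M N D_def[symmetric] mat_ring_simps mat_mult_smult dim)
  qed
  have "mat_trace (mat_inv M * N) = mat_trace (Y\<^sup>H * (D * Z\<^sup>H))"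
    by (simp only: inv N D_def[symmetric] mat_ring_simps dim mat_inverse_cancel[OF Z(4)])
  also have "\<dots> = mat_trace ((D * Z\<^sup>H) * Y\<^sup>H)"
    by (rule mat_trace_mult_commute[of _ n n]) (rule carrier_matI; simp only: mat_ring_simps dim)+
  also have "(D * Z\<^sup>H) * Y\<^sup>H = D"
    by (simp only: mat_ring_simps dim ZY)
  also have "mat_trace D = complex_of_real (\<Sum>i<n. d i)"
    by (simp add: mat_trace_def D_def mat_diag_def)
  finally have trace: "mat_trace (mat_inv M * N) = complex_of_real (\<Sum>i<n. d i)" .
  have det: "Re (det (M + complex_of_real t \<cdot>\<^sub>m N)) = Re (det M) * (\<Prod>i<n. 1 + t * d i)" for t
  proof -
    have c: "Z\<^sup>H \<in> carrier_mat n n" "E t \<in> carrier_mat n n" using Z by (simp_all add: E_def)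
    have "det (M + complex_of_real t \<cdot>\<^sub>m N) = det Z * det (E t) * det (Z\<^sup>H)"
      by (simp only: E det_mult[OF mult_carrier_mat[OF Z(1) c(2)] c(1)] det_mult[OF Z(1) c(2)])
    also have "\<dots> = det M * det (E t)"
      by (simp only: M det_mult[OF Z(1) c(1)] ac_simps)
    also have "det (E t) = complex_of_real (\<Prod>i<n. 1 + t * d i)"
      by (simp only: E_def det_mat_diag of_real_prod)
    finally show ?thesis
      by (simp only: times_complex.sel Re_complex_of_real Im_complex_of_real mult_zero_right diff_0_right)
  qed
  \<comment> \<open>Congruence with \<open>Y\<^sup>H\<close> in one direction and with
    \<open>Z\<^sup>H\<close> in the other transfers positivity between the pencil and
    \<open>E t\<close>.\<close>
  have posdef: "positive_definite (M + complex_of_real t \<cdot>\<^sub>m N) \<longleftrightarrow> (\<forall>i<n. 0 < 1 + t * d i)" for t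
  proof -
    have "Y * (Z * E t * Z\<^sup>H) * Y\<^sup>H = E t"
      by (simp only: mat_ring_simps dim mat_inverse_cancel[OF Z(4)] ZY)
    moreover have "Z * E t * Z\<^sup>H \<in> carrier_mat n n"
      by (rule carrier_matI) (simp_all only: mat_ring_simps dim)
    ultimately have "positive_definite (Z * E t * Z\<^sup>H) \<longleftrightarrow> positive_definite (E t)"
      using positive_definite_congruence[of "Z * E t * Z\<^sup>H" n "Y\<^sup>H" n "Z\<^sup>H"]
        positive_definite_congruence[of "E t" n "Z\<^sup>H" n "Y\<^sup>H"] Z(1,2) YZ ZY
      by (auto simp: E_def)
    then show ?thesis unfolding E unfolding E_def positive_definite_mat_diag .
  qed
  have "N = 0\<^sub>m n n" if "\<forall>i<n. d i = 0"
  proof -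
    have "D = 0\<^sub>m n n" by (rule eq_matI) (use that in \<open>auto simp: D_def mat_diag_def\<close>)
    then show ?thesis by (simp only: N D_def[symmetric] mat_ring_simps dim)
  qed
  with that trace det posdef show ?thesis by blast
qed

text \<open>\<open>det (M + N) / det M = \<Prod>(1 + d\<^sub>i)\<close> and \<open>ln (1 + d\<^sub>i) \<le> d\<^sub>i\<close>, strictly unless \<open>d\<^sub>i = 0\<close>.\<close>
lemma det_add_less:
  assumes pd: "positive_definite (M + N)" and tr: "mat_trace (mat_inv M * N) = 0"
    and N0: "N \<noteq> 0\<^sub>m n n"
  shows "Re (det (M + N)) < Re (det M)"
proof -
  obtain d where d: "mat_trace (mat_inv M * N) = complex_of_real (\<Sum>i<n. d i)"
    "\<And>t. Re (det (M + complex_of_real t \<cdot>\<^sub>m N)) = Re (det M) * (\<Prod>i<n. 1 + t * d i)"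
    "\<And>t. positive_definite (M + complex_of_real t \<cdot>\<^sub>m N) \<longleftrightarrow> (\<forall>i<n. 0 < 1 + t * d i)"
    "(\<forall>i<n. d i = 0) \<Longrightarrow> N = 0\<^sub>m n n"
    by (rule eigenvalues, rule that)
  have N1: "(1 :: complex) \<cdot>\<^sub>m N = N" by (rule eq_matI) auto
  have pos: "0 < 1 + d i" if "i < n" for i using d(3)[of 1] pd that by (simp add: N1)
  obtain k where k: "k < n" "d k \<noteq> 0" using d(4) N0 by blast
  have "ln (\<Prod>i<n. 1 + d i) = (\<Sum>i<n. ln (1 + d i))"
    by (rule ln_prod) (auto dest!: pos)
  also have "\<dots> < (\<Sum>i<n. d i)"
  proof (rule sum_strict_mono_ex1)
    show "\<forall>i\<in>{..<n}. ln (1 + d i) \<le> d i"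
      using ln_le_minus_one[OF pos] by auto
    have "ln (1 + d k) \<noteq> d k"
      using ln_eq_minus_one[OF pos[OF k(1)]] k(2) by auto
    with ln_le_minus_one[OF pos[OF k(1)]] k(1) show "\<exists>i\<in>{..<n}. ln (1 + d i) < d i"
      by (intro bexI[of _ k]) auto
  qed simp
  also have "\<dots> = 0" using tr unfolding d(1) by (simp only: of_real_eq_0_iff)
  finally have "(\<Prod>i<n. 1 + d i) < 1"
    using pos by (subst (asm) ln_less_zero_iff) (auto intro: prod_pos)
  then have "Re (det M) * (\<Prod>i<n. 1 + d i) < Re (det M)"
    using positive_definite_det(2)[OF M_pd M_carrier] by simp
  then show ?thesis using d(2)[of 1] by (simp add: N1)
qed

text \<open>Positivity of the pencil amounts to finitely many strict scalar inequalities that hold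
  at \<open>t = 0\<close>, hence on an interval around it.\<close>

lemma positive_definite_perturbation:
  obtains e where "0 < e"
    "\<And>t. \<bar>t\<bar> < e \<Longrightarrow> positive_definite (M + complex_of_real t \<cdot>\<^sub>m N)"
proof -
  obtain d where d:
    "\<And>t. positive_definite (M + complex_of_real t \<cdot>\<^sub>m N) \<longleftrightarrow> (\<forall>i<n. 0 < 1 + t * d i)"
    by (rule eigenvalues, rule that)
  \<comment> \<open>Dominates every \<open>d i\<close> in absolute value; the summand 1 keeps
    \<open>K\<close> positive even if all \<open>d i\<close> vanish, so that \<open>1 / K\<close> is
    a valid radius.\<close>
  define K where "K = 1 + (\<Sum>i<n. \<bar>d i\<bar>)"
  have K: "0 < K" unfolding K_def by (intro add_pos_nonneg sum_nonneg) auto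
  have "0 < 1 + t * d i" if t: "\<bar>t\<bar> < 1 / K" and i: "i < n" for t i
  proof -
    have "\<bar>d i\<bar> \<le> (\<Sum>i<n. \<bar>d i\<bar>)" using i by (intro member_le_sum) auto
    then have "\<bar>d i\<bar> \<le> K" by (simp add: K_def)
    then have "\<bar>t * d i\<bar> \<le> \<bar>t\<bar> * K" by (simp add: abs_mult mult_left_mono)
    also have "\<dots> < 1" using t K by (simp add: field_simps)
    finally show ?thesis by linarith
  qed
  with that[of "1 / K"] K d show ?thesis by auto
qed

text \<open>Relative to \<open>det M\<close>, the determinant is a product with value 1 at
  \<open>t = 0\<close>, and its derivative there is the trace.\<close>

lemma det_perturbation_increasing:
  assumes "0 < Re (mat_trace (mat_inv M * N))"
  obtains e where "0 < e"
    "\<And>t. 0 < t \<Longrightarrow> t < e \<Longrightarrow> Re (det M) < Re (det (M + complex_of_real t \<cdot>\<^sub>m N))"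
proof -
  obtain d where d: "mat_trace (mat_inv M * N) = complex_of_real (\<Sum>i<n. d i)"
    "\<And>t. Re (det (M + complex_of_real t \<cdot>\<^sub>m N)) = Re (det M) * (\<Prod>i<n. 1 + t * d i)"
    by (rule eigenvalues, rule that)
  \<comment> \<open>Stated for every prefix of the product, so that induction with the product rule
    applies; all factors equal 1 at 0.\<close>
  have "((\<lambda>t. \<Prod>i<k. 1 + t * d i) has_real_derivative (\<Sum>i<k. d i)) (at 0)" for k
  proof (induction k)
    case (Suc k)
    show ?case by (auto intro!: derivative_eq_intros Suc)
  qed simp
  from DERIV_pos_inc_right[OF this[of n]] assms d(1) obtain e where e: "e > 0"
    "\<And>h. 0 < h \<Longrightarrow> h < e \<Longrightarrow> (1::real) < (\<Prod>i<n. 1 + h * d i)"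
    by (auto simp del: of_real_sum)
  have "Re (det M) < Re (det (M + complex_of_real t \<cdot>\<^sub>m N))" if "0 < t" "t < e" for t :: real
    unfolding d(2) using positive_definite_det(2)[OF M_pd M_carrier] e(2)[OF that] by simp
  then show ?thesis by (rule that[OF e(1)])
qed

end

section \<open>Controllability\<close>

text \<open>Over the complex numbers the characteristic polynomial splits into linear factors, which
  is what a Schur form requires.\<close>

lemma schur_triangularization:
  fixes A :: "complex mat"
  assumes "A \<in> carrier_mat n n"
  obtains B P Q where "B \<in> carrier_mat n n" "P \<in> carrier_mat n n" "Q \<in> carrier_mat n n"
    "upper_triangular B" "P * Q = 1\<^sub>m n" "Q * P = 1\<^sub>m n" "A = P * B * Q"
proof -
  obtain as where "char_poly A = (\<Prod>a\<leftarrow>as. [:- a, 1:])"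
    using char_poly_factorized[OF assms] by blast
  from schur_decomposition_exists[OF assms this] obtain B P Q
    where "upper_triangular B" "similar_mat_wit A B P Q" unfolding similar_mat_def by blast
  with similar_mat_witD2[OF assms this(2)] that show ?thesis by blast
qed

text \<open>In a Schur basis, subtracting the right multiple of \<open>v\<close> from \<open>A v\<close> kills the last nonzero
  coordinate of \<open>v\<close>, so that iteration reaches an eigenvector.\<close>
lemma eigenvector_in_invariant_set:
  fixes A :: "complex mat"
  assumes A: "A \<in> carrier_mat n n" and S: "S \<subseteq> carrier_vec n"
    and inv: "\<And>v c. v \<in> S \<Longrightarrow> A *\<^sub>v v - c \<cdot>\<^sub>v v \<in> S"
    and v: "v \<in> S" "v \<noteq> 0\<^sub>v n"
  shows "\<exists>w\<in>S. \<exists>c. w \<noteq> 0\<^sub>v n \<and> A *\<^sub>v w = c \<cdot>\<^sub>v w"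
proof -
  from schur_triangularization[OF A] obtain B P Q where
    B: "B \<in> carrier_mat n n" and P: "P \<in> carrier_mat n n" and Q: "Q \<in> carrier_mat n n"
    and ut: "upper_triangular B" and PQ: "P * Q = 1\<^sub>m n" and QP: "Q * P = 1\<^sub>m n"
    and APBQ: "A = P * B * Q" by metis
  have QA: "Q * A = B * Q"
    using carrier_matD[OF B] carrier_matD[OF P] carrier_matD[OF Q]
    by (simp only: APBQ mat_mult_assoc mat_inverse_cancel[OF QP] index_mult_mat)
  \<comment> \<open>The induction variable \<open>k\<close> bounds the support of the coordinate
    vector \<open>Q *\<^sub>v v\<close>.\<close>
  have "\<exists>w\<in>S. \<exists>c. w \<noteq> 0\<^sub>v n \<and> A *\<^sub>v w = c \<cdot>\<^sub>v w"
    if "v \<in> S" "v \<noteq> 0\<^sub>v n" "\<And>i. k \<le> i \<Longrightarrow> i < n \<Longrightarrow> (Q *\<^sub>v v) $ i = 0" for k v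
    using that
  proof (induction k arbitrary: v)
    case 0
    have v: "v \<in> carrier_vec n" using 0 S by auto
    have "Q *\<^sub>v v = 0\<^sub>v n" by (rule eq_vecI) (use 0 Q in auto)
    moreover have "P *\<^sub>v (Q *\<^sub>v v) = v"
      using assoc_mult_mat_vec[OF P Q v] PQ v by simp
    moreover have "P *\<^sub>v 0\<^sub>v n = 0\<^sub>v n" by (rule eq_vecI) (use P in auto)
    ultimately show ?case using 0 by simp
  next
    case (Suc k)
    have v: "v \<in> carrier_vec n" using Suc.prems S by auto
    define u where "u = Q *\<^sub>v v"
    have u: "u \<in> carrier_vec n" using Q v by (auto simp: u_def)
    have u0: "u $ i = 0" if "Suc k \<le> i" "i < n" for i using Suc.prems(3) that by (simp add: u_def)
    \<comment> \<open>Coordinates of \<open>u\<close> beyond \<open>k\<close> vanish and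
      \<open>B\<close> is upper triangular, so coordinate \<open>k\<close> of \<open>B u\<close> is
      this diagonal entry times \<open>u $ k\<close>.\<close>
    define c where "c = B $$ (k, k)"
    define w where "w = A *\<^sub>v v - c \<cdot>\<^sub>v v"
    have "Q *\<^sub>v w = Q *\<^sub>v (A *\<^sub>v v) - Q *\<^sub>v (c \<cdot>\<^sub>v v)"
      unfolding w_def by (rule mult_minus_distrib_mat_vec[OF Q]) (use A v in auto)
    also have "Q *\<^sub>v (A *\<^sub>v v) = B *\<^sub>v u"
      using assoc_mult_mat_vec[OF Q A v] assoc_mult_mat_vec[OF B Q v] QA by (simp add: u_def)
    also have "Q *\<^sub>v (c \<cdot>\<^sub>v v) = c \<cdot>\<^sub>v u"
      unfolding u_def by (rule mult_mat_vec[OF Q v])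
    finally have Qw: "Q *\<^sub>v w = B *\<^sub>v u - c \<cdot>\<^sub>v u" .
    have Qw0: "(Q *\<^sub>v w) $ i = 0" if i: "k \<le> i" "i < n" for i
    proof -
      have "(B *\<^sub>v u) $ i = (\<Sum>j<n. B $$ (i, j) * u $ j)"
        using i B u by (simp add: scalar_prod_def lessThan_atLeast0)
      also have "\<dots> = (\<Sum>j<n. if j = k then (if i = k then c * u $ i else 0) else 0)"
      proof (rule sum.cong)
        fix j assume "j \<in> {..<n}"
        then have j: "j < n" by simp
        show "B $$ (i, j) * u $ j = (if j = k then (if i = k then c * u $ i else 0) else 0)"
        proof (cases "j < i")
          case True
          then have "B $$ (i, j) = 0" using ut i B by (auto simp: upper_triangular_def)
          then show ?thesis using True by auto
        next
          case False
          then show ?thesis using u0[of j] j i by (cases "j = k") (auto simp: c_def)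
        qed
      qed simp
      also have "\<dots> = c * u $ i" using i u0[of i] by (cases "i = k") auto
      finally show ?thesis unfolding Qw using i u B by simp
    qed
    \<comment> \<open>Either \<open>v\<close> is already an eigenvector, or \<open>w\<close> is a
      nonzero member of \<open>S\<close> with smaller support.\<close>
    show ?case
    proof (cases "w = 0\<^sub>v n")
      case True
      have "A *\<^sub>v v = c \<cdot>\<^sub>v v"
      proof (rule eq_vecI)
        fix i assume "i < dim_vec (c \<cdot>\<^sub>v v)"
        then show "(A *\<^sub>v v) $ i = (c \<cdot>\<^sub>v v) $ i"
          using arg_cong[OF True, of "\<lambda>w. w $ i"] A v by (simp add: w_def)
      qed (use A v in auto)
      then show ?thesis using Suc.prems by blast
    next
      case False
      show ?thesis
        by (rule Suc.IH[OF _ False]) (use Qw0 inv[OF Suc.prems(1), of c] in \<open>auto simp: w_def\<close>)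
    qed
  qed
  \<comment> \<open>At \<open>k = n\<close> the support condition is vacuous.\<close>
  from this[OF v, of n] show ?thesis by simp
qed

text \<open>Supplies the set needed to read the rank as the cardinality of a maximal independent set
  of columns; the empty set starts the extension.\<close>

lemma (in vec_space) maximal_indpt_cols:
  "\<exists>S. maximal S (\<lambda>T. T \<subseteq> set (cols K) \<and> lin_indpt T)"
proof -
  have "lin_indpt {}" by (simp add: lin_dep_def)
  then show ?thesis
    using maximal_exists_superset[of "set (cols K)" "\<lambda>T. T \<subseteq> set (cols K) \<and> lin_indpt T" "{}"] by blast
qed

text \<open>Full row rank provides \<open>n\<close> independent columns. They form an invertible
  square matrix \<open>T\<close>, and a vector orthogonal to all of them lies in the kernel of a
  matrix with nonzero determinant.\<close>

lemma full_row_rank_orthogonal_eq_0: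
  fixes K :: "complex mat"
  assumes K: "K \<in> carrier_mat n k" and rank: "vec_space.rank n K = n" and w: "w \<in> carrier_vec n"
    and orth: "\<And>j. j < k \<Longrightarrow> col K j \<bullet>c w = 0"
  shows "w = 0\<^sub>v n"
proof (rule ccontr)
  assume w0: "w \<noteq> 0\<^sub>v n"
  interpret vec_space "TYPE(complex)" n .
  obtain S where S: "maximal S (\<lambda>T. T \<subseteq> set (cols K) \<and> lin_indpt T)"
    using maximal_indpt_cols by blast
  then have sub: "S \<subseteq> set (cols K)" and li: "lin_indpt S" by (auto simp: maximal_def)
  obtain xs where xs: "set xs = S" "distinct xs"
    using finite_distinct_list[OF finite_subset[OF sub]] by auto
  have "length xs = n"
    using rank_card_indpt[OF K S] rank xs by (simp add: distinct_card[symmetric])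
  moreover have "set xs \<subseteq> carrier_vec n"
    using sub xs cols_dim[of K] K by auto
  moreover define T where "T = mat_of_cols n xs"
  ultimately have Tc: "T \<in> carrier_mat n n" "cols T = xs"
    by auto
  have "det T \<noteq> 0"
    using det_rank_iff[OF Tc(1)] lin_indpt_full_rank[OF Tc(1)] Tc(2) xs li by simp
  \<comment> \<open>The form \<open>\<bullet>c\<close> conjugates its second argument, so
    orthogonality to the columns is a statement about the plain transpose and the conjugate of
    \<open>w\<close>.\<close>
  moreover have "T\<^sup>T *\<^sub>v conjugate w = 0\<^sub>v n"
  proof (rule eq_vecI)
    fix i assume "i < dim_vec (0\<^sub>v n :: complex vec)"
    then have i: "i < n" by simp
    then have "col T i \<in> set (cols T)" using Tc(1) by (auto simp: cols_def)
    then have "col T i \<in> set (cols K)" using Tc(2) xs sub by auto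
    then obtain j where "j < k" "col T i = col K j" using K by (auto simp: cols_def)
    with orth i Tc(1) show "(T\<^sup>T *\<^sub>v conjugate w) $ i = 0\<^sub>v n $ i" by simp
  qed (use Tc in auto)
  moreover have "conjugate w \<noteq> 0\<^sub>v n" using w0 w by simp
  ultimately show False
    using det_0_iff_vec_prod_zero_field[of "T\<^sup>T" n] det_transpose[OF Tc(1)] Tc(1) w
    by (metis carrier_vec_conjugate transpose_carrier_mat)
qed

text \<open>One direction of the Hautus test: such a \<open>w\<close> is orthogonal to all columns
  of the block row at \<open>cnj e\<close>, which has full row rank.\<close>

lemma controllable_eigenvector_eq_0:
  fixes A B :: "complex mat"
  assumes A: "A \<in> carrier_mat n n" and B: "B \<in> carrier_mat n m" and ctrl: "controllable A B"
    and w: "w \<in> carrier_vec n" "A\<^sup>H *\<^sub>v w = e \<cdot>\<^sub>v w" "B\<^sup>H *\<^sub>v w = 0\<^sub>v m"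
  shows "w = 0\<^sub>v n"
proof -
  \<comment> \<open>Taking adjoints, \<open>A\<^sup>H *\<^sub>v w = e \<cdot>\<^sub>v w\<close>
    makes \<open>w\<close> a left eigenvector of \<open>A\<close> for the conjugate
    eigenvalue.\<close>
  define l where "l = cnj e"
  define K where "K = block_row (l \<cdot>\<^sub>m 1\<^sub>m n - A) B"
  have K: "K \<in> carrier_mat n (n + m)"
    unfolding K_def block_row_def carrier_mat_def using A B by simp
  have Kl: "K $$ (i, j) = (if i = j then l else 0) - A $$ (i, j)" if "i < n" "j < n" for i j
    unfolding K_def block_row_def using A B that by simp
  have Kr: "K $$ (i, n + j) = B $$ (i, j)" if "i < n" "j < m" for i j
    unfolding K_def block_row_def using A B that by simp
  have "vec_space.rank n K = n"
    using ctrl A unfolding controllable_def K_def by simp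
  then show ?thesis
  proof (rule full_row_rank_orthogonal_eq_0[OF K _ w(1)])
    fix j assume j: "j < n + m"
    show "col K j \<bullet>c w = 0"
    proof (cases "j < n")
      case True
      have "cnj (col K j \<bullet>c w) = (\<Sum>i<n. cnj (K $$ (i, j)) * w $ i)"
        using j K w(1) by (simp add: scalar_prod_def lessThan_atLeast0)
      also have "\<dots> = (\<Sum>i<n. (if i = j then e * w $ j else 0) - A\<^sup>H $$ (j, i) * w $ i)"
        by (rule sum.cong) (use True A in \<open>auto simp: Kl l_def left_diff_distrib\<close>)
      also have "\<dots> = e * w $ j - (A\<^sup>H *\<^sub>v w) $ j"
        using True A w(1) by (simp add: sum_subtractf scalar_prod_def lessThan_atLeast0)
      also have "\<dots> = 0" unfolding w(2) using True w(1) by simp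
      finally show ?thesis by simp
    next
      case False
      define i' where "i' = j - n"
      have i': "i' < m" "j = n + i'" using False j by (auto simp: i'_def)
      have "cnj (col K j \<bullet>c w) = (\<Sum>i<n. cnj (K $$ (i, n + i')) * w $ i)"
        using j K w(1) i' by (simp add: scalar_prod_def lessThan_atLeast0)
      also have "\<dots> = (\<Sum>i<n. B\<^sup>H $$ (i', i) * w $ i)"
        by (rule sum.cong) (use i' B Kr in auto)
      also have "\<dots> = (B\<^sup>H *\<^sub>v w) $ i'"
        using i' B w(1) by (simp add: scalar_prod_def lessThan_atLeast0)
      also have "\<dots> = 0" unfolding w(3) using i' by simp
      finally show ?thesis by simp
    qed
  qed
qed

text \<open>The range of \<open>\<Delta>\<close> is invariant under \<open>A\<^sup>H\<close> and annihilated by \<open>B\<^sup>H\<close>.\<close>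
lemma controllable_lyapunov_eq_0:
  fixes A B :: "complex mat"
  assumes A: "A \<in> carrier_mat n n" and B: "B \<in> carrier_mat n m" and ctrl: "controllable A B"
    and D: "\<Delta> \<in> carrier_mat n n" "\<Delta>\<^sup>H = \<Delta>"
    and DA: "\<Delta> * A + A\<^sup>H * \<Delta> = 0\<^sub>m n n" and DB: "\<Delta> * B = 0\<^sub>m n m"
  shows "\<Delta> = 0\<^sub>m n n"
proof (rule ccontr)
  assume "\<Delta> \<noteq> 0\<^sub>m n n"
  then obtain i j where ij: "i < n" "j < n" "\<Delta> $$ (i, j) \<noteq> 0"
    using D(1) by (metis carrier_matD eq_matI index_zero_mat)
  define S where "S = (\<lambda>x. \<Delta> *\<^sub>v x) ` carrier_vec n"
  have S: "S \<subseteq> carrier_vec n" using D(1) by (auto simp: S_def)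
  have AH: "A\<^sup>H \<in> carrier_mat n n" using A by simp
  have "A\<^sup>H * \<Delta> = - (\<Delta> * A)"
    using mat_add_eq_0_iff[OF mult_carrier_mat[OF D(1) A] mult_carrier_mat[OF AH D(1)]] DA by simp
  also have "\<dots> = \<Delta> * (- A)" using A D(1) by simp
  finally have AD: "A\<^sup>H * \<Delta> = \<Delta> * (- A)" .
  \<comment> \<open>The Lyapunov equation turns \<open>A\<^sup>H\<close> acting on
    \<open>\<Delta> x\<close> into \<open>\<Delta>\<close> acting on \<open>- A x\<close>, so the
    result stays in the range.\<close>
  have inv: "A\<^sup>H *\<^sub>v v - c \<cdot>\<^sub>v v \<in> S" if "v \<in> S" for v c
  proof -
    from that obtain x where x: "x \<in> carrier_vec n" "v = \<Delta> *\<^sub>v x" by (auto simp: S_def)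
    have mA: "- A \<in> carrier_mat n n" using A by simp
    have "A\<^sup>H *\<^sub>v v = \<Delta> *\<^sub>v (- A *\<^sub>v x)"
      unfolding x(2) using assoc_mult_mat_vec[OF AH D(1) x(1)] assoc_mult_mat_vec[OF D(1) mA x(1)] AD
      by simp
    moreover have "c \<cdot>\<^sub>v v = \<Delta> *\<^sub>v (c \<cdot>\<^sub>v x)"
      unfolding x(2) by (rule mult_mat_vec[OF D(1) x(1), symmetric])
    moreover have "\<Delta> *\<^sub>v (- A *\<^sub>v x) - \<Delta> *\<^sub>v (c \<cdot>\<^sub>v x) = \<Delta> *\<^sub>v (- A *\<^sub>v x - c \<cdot>\<^sub>v x)"
      by (rule mult_minus_distrib_mat_vec[OF D(1), symmetric]) (use mA x in auto)
    moreover have "- A *\<^sub>v x - c \<cdot>\<^sub>v x \<in> carrier_vec n" using mA x by auto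
    ultimately show ?thesis by (auto simp: S_def)
  qed
  have "(\<Delta> *\<^sub>v unit_vec n j) $ i \<noteq> 0" using ij D(1) by simp
  then have "\<Delta> *\<^sub>v unit_vec n j \<noteq> 0\<^sub>v n" using ij by auto
  moreover have "\<Delta> *\<^sub>v unit_vec n j \<in> S" by (auto simp: S_def)
  ultimately obtain w e where w: "w \<in> S" "w \<noteq> 0\<^sub>v n" "A\<^sup>H *\<^sub>v w = e \<cdot>\<^sub>v w"
    using eigenvector_in_invariant_set[OF AH S inv] by blast
  from w(1) obtain x where x: "x \<in> carrier_vec n" "w = \<Delta> *\<^sub>v x" by (auto simp: S_def)
  \<comment> \<open>The adjoint of \<open>\<Delta> * B = 0\<close>; \<open>\<Delta>\<close> being
    Hermitian puts it on the right.\<close>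
  have BD: "B\<^sup>H * \<Delta> = 0\<^sub>m m n"
    using arg_cong[OF DB, of mat_adjoint] B D by (simp add: mat_adjoint_mult)
  have "B\<^sup>H *\<^sub>v w = (B\<^sup>H * \<Delta>) *\<^sub>v x"
    unfolding x(2) using B by (intro assoc_mult_mat_vec[OF _ D(1) x(1), symmetric]) auto
  also have "\<dots> = 0\<^sub>v m" unfolding BD using x(1) by (intro eq_vecI) auto
  finally have "B\<^sup>H *\<^sub>v w = 0\<^sub>v m" .
  from controllable_eigenvector_eq_0[OF A B ctrl _ w(3) this] w S show False by blast
qed

section \<open>Analytic centers\<close>

text \<open>A diagonal block is the congruence of the whole matrix with the embedding of the
  corresponding coordinates.\<close>

lemma positive_definite_block:
  assumes pd: "positive_definite (four_block_mat M1 M2 M3 M4)"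
    and M: "M1 \<in> carrier_mat a a" "M2 \<in> carrier_mat a b" "M3 \<in> carrier_mat b a" "M4 \<in> carrier_mat b b"
  shows "positive_definite M1" "positive_definite M4"
proof -
  let ?M = "four_block_mat M1 M2 M3 M4"
  \<comment> \<open>The coordinate embeddings are written as block matrices with blocks of no
    columns, so that block multiplication applies to them.\<close>
  define K :: "complex mat" where "K = four_block_mat (1\<^sub>m a) (0\<^sub>m a 0) (0\<^sub>m b a) (0\<^sub>m b 0)"
  define L :: "complex mat" where "L = four_block_mat (0\<^sub>m a 0) (0\<^sub>m a b) (0\<^sub>m b 0) (1\<^sub>m b)"
  have c: "?M \<in> carrier_mat (a + b) (a + b)" using M by auto
  have K: "K \<in> carrier_mat (a + b) a" and L: "L \<in> carrier_mat (a + b) b"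
    by (rule carrier_matI; simp add: K_def L_def)+
  have KH: "K\<^sup>H = four_block_mat (1\<^sub>m a) (0\<^sub>m a b) (0\<^sub>m 0 a) (0\<^sub>m 0 b)"
    and LH: "L\<^sup>H = four_block_mat (0\<^sub>m 0 a) (0\<^sub>m 0 b) (0\<^sub>m b a) (1\<^sub>m b)"
    by (rule eq_matI; auto simp: K_def L_def)+
  have M_K: "?M * K = four_block_mat M1 (0\<^sub>m a 0) M3 (0\<^sub>m b 0)"
    unfolding K_def using M by (subst mult_four_block_mat[of _ a a _ b _ b]) auto
  have M_L: "?M * L = four_block_mat (0\<^sub>m a 0) M2 (0\<^sub>m b 0) M4"
    unfolding L_def using M by (subst mult_four_block_mat[of _ a a _ b _ b]) auto
  have KMK: "K\<^sup>H * ?M * K = M1"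
  proof -
    have "K\<^sup>H * ?M * K = K\<^sup>H * (?M * K)"
      using carrier_matD[OF K] carrier_matD[OF c] by (simp only: mat_mult_assoc dim_mat_adjoint)
    also have "\<dots> = M1"
      unfolding M_K KH using M by (subst mult_four_block_mat[of _ a a _ b _ 0]) (auto intro!: eq_matI)
    finally show ?thesis .
  qed
  have LML: "L\<^sup>H * ?M * L = M4"
  proof -
    have "L\<^sup>H * ?M * L = L\<^sup>H * (?M * L)"
      using carrier_matD[OF L] carrier_matD[OF c] by (simp only: mat_mult_assoc dim_mat_adjoint)
    also have "\<dots> = M4"
      unfolding M_L LH using M by (subst mult_four_block_mat[of _ 0 a _ b _ b]) (auto intro!: eq_matI)
    finally show ?thesis .
  qed
  have KK: "K\<^sup>H * K = 1\<^sub>m a"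
    unfolding KH unfolding K_def by (subst mult_four_block_mat[of _ a a _ b _ 0]) (auto intro!: eq_matI)
  have LL: "L\<^sup>H * L = 1\<^sub>m b"
    unfolding LH unfolding L_def by (subst mult_four_block_mat[of _ 0 a _ b _ b]) (auto intro!: eq_matI)
  have KHc: "K\<^sup>H \<in> carrier_mat a (a + b)" and LHc: "L\<^sup>H \<in> carrier_mat b (a + b)"
    using K L by simp_all
  show "positive_definite M1"
    by (rule subst[OF KMK, of positive_definite, OF positive_definite_congruence[OF pd c K KHc KK]])
  show "positive_definite M4"
    by (rule subst[OF LML, of positive_definite, OF positive_definite_congruence[OF pd c L LHc LL]])
qed

text \<open>Existence and uniqueness of the minimizer merge into one strict inequality, because a
  tie with the minimum would be a second minimizer.\<close>

lemma is_analytic_center_iff: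
  "is_analytic_center A B C D X \<longleftrightarrow> X \<in> Xc A B C D \<and>
    (\<forall>Y \<in> Xc A B C D. Y \<noteq> X \<longrightarrow> barrier A B C D X < barrier A B C D Y)"
proof
  assume "is_analytic_center A B C D X"
  then have X: "X \<in> Xc A B C D" and min: "\<And>Y. Y \<in> Xc A B C D \<Longrightarrow> barrier A B C D X \<le> barrier A B C D Y"
    and uniq: "\<And>Y. is_arg_min (barrier A B C D) (\<lambda>Z. Z \<in> Xc A B C D) Y \<Longrightarrow> Y = X"
    unfolding is_analytic_center_def is_arg_min_linorder by simp_all
  have "barrier A B C D X < barrier A B C D Y" if Y: "Y \<in> Xc A B C D" "Y \<noteq> X" for Y
  proof (rule ccontr)
    assume "\<not> barrier A B C D X < barrier A B C D Y"
    then have "is_arg_min (barrier A B C D) (\<lambda>Z. Z \<in> Xc A B C D) Y"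
      unfolding is_arg_min_linorder using min Y(1) by (meson linorder_not_less order_trans)
    with uniq Y(2) show False by blast
  qed
  with X show "X \<in> Xc A B C D \<and>
      (\<forall>Y \<in> Xc A B C D. Y \<noteq> X \<longrightarrow> barrier A B C D X < barrier A B C D Y)"
    by blast
next
  assume X: "X \<in> Xc A B C D \<and>
    (\<forall>Y \<in> Xc A B C D. Y \<noteq> X \<longrightarrow> barrier A B C D X < barrier A B C D Y)"
  then have "is_arg_min (barrier A B C D) (\<lambda>Z. Z \<in> Xc A B C D) X"
    unfolding is_arg_min_linorder by (metis less_imp_le order_refl)
  moreover have "Y = X" if "is_arg_min (barrier A B C D) (\<lambda>Z. Z \<in> Xc A B C D) Y" for Y
    using that X unfolding is_arg_min_linorder by (meson linorder_not_less)
  ultimately show "is_analytic_center A B C D X"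
    unfolding is_analytic_center_def by blast
qed

section \<open>Schur complement and trace formula at a feasible point\<close>

locale kyp_point =
  fixes A B C D X :: "complex mat" and n m :: nat
  assumes A: "A \<in> carrier_mat n n" and B: "B \<in> carrier_mat n m"
    and C: "C \<in> carrier_mat m n" and D: "D \<in> carrier_mat m m"
    and X_Xc: "X \<in> Xc A B C D"
begin

abbreviation "W \<equiv> Wc A B C D X"
abbreviation "R \<equiv> D + D\<^sup>H"
abbreviation "F \<equiv> Fc B C D X"
abbreviation "P \<equiv> Pc A B C D X"
abbreviation "AF \<equiv> AFc A B C D X"
text \<open>The gradient of the barrier in the trace pairing: the derivative at \<open>X\<close> in
  direction \<open>\<Delta>\<close> is the trace of \<open>\<Delta> * G\<close>.\<close>

abbreviation "G \<equiv> AF * mat_inv P + mat_inv P * AF\<^sup>H"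

definition "dW \<Delta> = four_block_mat (- (\<Delta> * A) - A\<^sup>H * \<Delta>) (- (\<Delta> * B)) (- (B\<^sup>H * \<Delta>)) (0\<^sub>m m m)"
definition "T = four_block_mat (1\<^sub>m n) (0\<^sub>m n m) (- F) (1\<^sub>m m)"
definition "S = four_block_mat (1\<^sub>m n) (0\<^sub>m n m) F (1\<^sub>m m)"

lemma X: "X \<in> carrier_mat n n" "X\<^sup>H = X" "positive_definite W" "positive_definite X"
  using X_Xc A by (auto simp: Xc_def)

lemma dim0: "dim_row A = n" "dim_col A = n" "dim_row B = n" "dim_col B = m" "dim_row C = m" "dim_col C = n"
  "dim_row D = m" "dim_col D = m" "dim_row X = n" "dim_col X = n"
  using A B C D X by auto

lemma W_carrier: "W \<in> carrier_mat (n + m) (n + m)"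
  unfolding Wc_def
  by (rule four_block_carrier_mat; rule carrier_matI; simp only: mat_ring_simps dim0)

lemma R: "R \<in> carrier_mat m m" "positive_definite R" "R\<^sup>H = R"
proof -
  show c: "R \<in> carrier_mat m m" using D by simp
  show "positive_definite R"
    by (rule positive_definite_block(2)[of _ _ _ _ n m])
      (use X(3) c in \<open>simp only: Wc_def\<close>; rule carrier_matI; simp only: mat_ring_simps dim0)+
  then show "R\<^sup>H = R" using c by (simp only: positive_definite_iff)
qed

lemma R_inv: "mat_inv R \<in> carrier_mat m m" "R * mat_inv R = 1\<^sub>m m" "mat_inv R * R = 1\<^sub>m m"
  "(mat_inv R)\<^sup>H = mat_inv R"
  using positive_definite_mat_inv[OF R(2,1)] by auto

lemma dimF: "dim_row F = m" "dim_col F = n"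
  using R_inv(1) by (simp_all only: Fc_def mat_ring_simps dim0 carrier_matD)

lemma dim1: "dim_row P = n" "dim_col P = n" "dim_row AF = n" "dim_col AF = n"
  by (simp_all only: Pc_def AFc_def mat_ring_simps dim0 dimF)

text \<open>Expresses the off-diagonal blocks of \<open>W\<close> through \<open>F\<close>; this is
  why elimination with \<open>F\<close> clears both of them.\<close>

lemma RF: "R * F = C - B\<^sup>H * X" "F\<^sup>H * R = C\<^sup>H - X * B"
proof -
  show *: "R * F = C - B\<^sup>H * X"
    unfolding Fc_def
    by (rule mat_inverse_cancel[OF R_inv(2)]) (use R_inv(1) in \<open>simp_all only: mat_ring_simps dim0 carrier_matD\<close>)
  have "F\<^sup>H * R = (R * F)\<^sup>H"
    by (subst mat_adjoint_mult) (simp_all only: mat_ring_simps index_add_mat dim0 dimF R(3))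
  also have "\<dots> = C\<^sup>H - X * B"
    unfolding * by (simp only: mat_ring_simps dim0 X(2))
  finally show "F\<^sup>H * R = C\<^sup>H - X * B" .
qed

lemma T_carrier: "T \<in> carrier_mat (n + m) (n + m)"
  using dimF by (auto simp: T_def)

lemma S_carrier: "S \<in> carrier_mat (n + m) (n + m)"
  using dimF by (auto simp: S_def)

lemma F_carrier: "F \<in> carrier_mat m n" "- F \<in> carrier_mat m n" "- (F\<^sup>H) \<in> carrier_mat n m"
  using dimF by auto

lemma T_adjoint: "T\<^sup>H = four_block_mat (1\<^sub>m n) (- (F\<^sup>H)) (0\<^sub>m m n) (1\<^sub>m m)"
  unfolding T_def using F_carrier by (subst mat_adjoint_four_block[of _ n n _ m _ m]) auto

lemma T_S: "T * S = 1\<^sub>m (n + m)"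
  unfolding T_def S_def using F_carrier
  by (subst mult_four_block_mat[of _ n n _ m _ m _ _ n _ m]) (auto simp: mat_add_cancel)

lemma S_T: "S * T = 1\<^sub>m (n + m)"
  by (rule mat_mult_left_right_inverse[OF T_carrier S_carrier T_S])

lemma SH_TH: "S\<^sup>H * T\<^sup>H = 1\<^sub>m (n + m)"
  using arg_cong[OF T_S, of mat_adjoint] T_carrier S_carrier by (simp add: mat_adjoint_mult)

lemma P_carrier: "P \<in> carrier_mat n n"
  by (rule carrier_matI) (simp_all only: dim1)

text \<open>Block elimination with pivot \<open>R\<close>: \<open>P\<close> is the Schur complement
  of \<open>R\<close> in \<open>W\<close>.\<close>

lemma congruence_W: "T\<^sup>H * W * T = four_block_mat P (0\<^sub>m n m) (0\<^sub>m m n) R"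
proof -
  have c: "- (X * A) - A\<^sup>H * X \<in> carrier_mat n n" "C\<^sup>H - X * B \<in> carrier_mat n m"
    "C - B\<^sup>H * X \<in> carrier_mat m n"
    by (rule carrier_matI; simp only: mat_ring_simps dim0)+
  have "W * T = four_block_mat ((- (X * A) - A\<^sup>H * X) * 1\<^sub>m n + (C\<^sup>H - X * B) * - F)
      ((- (X * A) - A\<^sup>H * X) * 0\<^sub>m n m + (C\<^sup>H - X * B) * 1\<^sub>m m)
      ((C - B\<^sup>H * X) * 1\<^sub>m n + R * - F) ((C - B\<^sup>H * X) * 0\<^sub>m n m + R * 1\<^sub>m m)"
    unfolding Wc_def T_def
    by (rule mult_four_block_mat[OF c R(1) one_carrier_mat zero_carrier_mat F_carrier(2) one_carrier_mat])
  \<comment> \<open>The right factor clears only the lower left block; the remaining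
    \<open>F\<^sup>H * R\<close> is removed by \<open>T\<^sup>H\<close>.\<close>
  also have "\<dots> = four_block_mat P (F\<^sup>H * R) (0\<^sub>m m n) R"
    unfolding RF[symmetric] Pc_def
    by (rule cong_four_block_mat) (simp_all only: mat_ring_simps dim0 dimF)
  finally have W_T: "W * T = four_block_mat P (F\<^sup>H * R) (0\<^sub>m m n) R" .
  have FR: "F\<^sup>H * R \<in> carrier_mat n m"
    by (rule carrier_matI; simp only: mat_ring_simps dim0 dimF)
  have "T\<^sup>H * W * T = T\<^sup>H * (W * T)"
    using carrier_matD[OF T_carrier] carrier_matD[OF W_carrier]
    by (simp only: mat_mult_assoc dim_mat_adjoint)
  also have "\<dots> = four_block_mat (1\<^sub>m n * P + - (F\<^sup>H) * 0\<^sub>m m n) (1\<^sub>m n * (F\<^sup>H * R) + - (F\<^sup>H) * R)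
      (0\<^sub>m m n * P + 1\<^sub>m m * 0\<^sub>m m n) (0\<^sub>m m n * (F\<^sup>H * R) + 1\<^sub>m m * R)"
    unfolding W_T T_adjoint
    by (rule mult_four_block_mat[OF one_carrier_mat F_carrier(3) zero_carrier_mat one_carrier_mat
          P_carrier FR zero_carrier_mat R(1)])
  also have "\<dots> = four_block_mat P (0\<^sub>m n m) (0\<^sub>m m n) R"
    by (rule cong_four_block_mat) (simp_all only: mat_ring_simps dim0 dimF dim1)
  finally show ?thesis .
qed

lemma P_pd: "positive_definite P"
proof -
  have "positive_definite (T\<^sup>H * W * T)"
    by (rule positive_definite_congruence[OF X(3) W_carrier T_carrier S_carrier S_T])
  then show ?thesis
    unfolding congruence_W by (rule positive_definite_block(1)[OF _ P_carrier zero_carrier_mat zero_carrier_mat R(1)])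
qed

lemma P_inv: "mat_inv P \<in> carrier_mat n n" "P * mat_inv P = 1\<^sub>m n" "mat_inv P * P = 1\<^sub>m n"
  "(mat_inv P)\<^sup>H = mat_inv P"
  using positive_definite_mat_inv[OF P_pd P_carrier] by auto

lemma dimPi: "dim_row (mat_inv P) = n" "dim_col (mat_inv P) = n"
  using P_inv(1) by auto

lemma G: "G \<in> carrier_mat n n" "G\<^sup>H = G"
  by (rule carrier_matI; simp only: mat_ring_simps dim1 dimPi)
    (simp only: mat_ring_simps dim1 dimPi P_inv(4))

text \<open>Inverting the block diagonalization puts \<open>T\<close> and \<open>T\<^sup>H\<close>
  outside, exactly where the trace needs them; \<open>S\<close> appears only in the
  verification.\<close>

lemma mat_inv_W: "mat_inv W = T * four_block_mat (mat_inv P) (0\<^sub>m n m) (0\<^sub>m m n) (mat_inv R) * T\<^sup>H"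
proof (rule mat_inv_eqI[OF W_carrier])
  let ?V = "four_block_mat P (0\<^sub>m n m) (0\<^sub>m m n) R"
  let ?V' = "four_block_mat (mat_inv P) (0\<^sub>m n m) (0\<^sub>m m n) (mat_inv R)"
  have V: "?V \<in> carrier_mat (n + m) (n + m)" "?V' \<in> carrier_mat (n + m) (n + m)"
    using four_block_carrier_mat[OF P_carrier R(1)] four_block_carrier_mat[OF P_inv(1) R_inv(1)] by auto
  have VV: "?V * ?V' = 1\<^sub>m (n + m)"
    by (simp only: mult_block_diag[OF P_carrier R(1) P_inv(1) R_inv(1)] P_inv(2) R_inv(2) four_block_one_mat)
  note dims = carrier_matD[OF V(1)] carrier_matD[OF V(2)] carrier_matD[OF T_carrier] carrier_matD[OF S_carrier]
    carrier_matD[OF W_carrier]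
  show "T * ?V' * T\<^sup>H \<in> carrier_mat (n + m) (n + m)"
    by (rule carrier_matI) (simp_all only: index_mult_mat dim_mat_adjoint dims)
  have W_eq: "W = S\<^sup>H * (?V * S)"
  proof -
    have "S\<^sup>H * (?V * S) = S\<^sup>H * (T\<^sup>H * (W * (T * S)))"
      unfolding congruence_W[symmetric]
      by (simp only: mat_mult_assoc index_mult_mat dim_mat_adjoint dims)
    also have "\<dots> = W"
      by (simp only: T_S mat_mult_one mat_inverse_cancel[OF SH_TH] index_mult_mat dim_mat_adjoint dims)
    finally show ?thesis by simp
  qed
  have "W * (T * ?V' * T\<^sup>H) = S\<^sup>H * (?V * (S * (T * (?V' * T\<^sup>H))))"
    unfolding W_eq by (simp only: mat_mult_assoc index_mult_mat dim_mat_adjoint dims)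
  also have "\<dots> = 1\<^sub>m (n + m)"
    by (simp only: mat_inverse_cancel[OF S_T] mat_inverse_cancel[OF VV] SH_TH
        index_mult_mat dim_mat_adjoint dims)
  finally show "W * (T * ?V' * T\<^sup>H) = 1\<^sub>m (n + m)" .
qed

context
  fixes \<Delta> :: "complex mat"
  assumes Delta: "\<Delta> \<in> carrier_mat n n" "\<Delta>\<^sup>H = \<Delta>"
begin

lemma dimD: "dim_row \<Delta> = n" "dim_col \<Delta> = n"
  using Delta by auto

lemma dW_blocks:
  "- (\<Delta> * A) - A\<^sup>H * \<Delta> \<in> carrier_mat n n" "- (\<Delta> * B) \<in> carrier_mat n m"
  "- (B\<^sup>H * \<Delta>) \<in> carrier_mat m n"
  by (rule carrier_matI; simp only: mat_ring_simps dim0 dimD)+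

lemma dW: "dW \<Delta> \<in> carrier_mat (n + m) (n + m)" "(dW \<Delta>)\<^sup>H = dW \<Delta>"
proof -
  show "dW \<Delta> \<in> carrier_mat (n + m) (n + m)"
    unfolding dW_def by (rule four_block_carrier_mat[OF dW_blocks(1)]) simp
  show "(dW \<Delta>)\<^sup>H = dW \<Delta>"
    unfolding dW_def mat_adjoint_four_block[OF dW_blocks zero_carrier_mat]
    by (rule cong_four_block_mat) (simp_all only: mat_ring_simps dim0 dimD Delta(2))
qed

lemma Wc_perturbation:
  "Wc A B C D (X + complex_of_real t \<cdot>\<^sub>m \<Delta>) = W + complex_of_real t \<cdot>\<^sub>m dW \<Delta>"
proof -
  let ?t = "complex_of_real t"
  have c: "- (X * A) - A\<^sup>H * X \<in> carrier_mat n n" "C\<^sup>H - X * B \<in> carrier_mat n m"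
    "C - B\<^sup>H * X \<in> carrier_mat m n"
    by (rule carrier_matI; simp only: mat_ring_simps dim0)+
  have c': "?t \<cdot>\<^sub>m (- (\<Delta> * A) - A\<^sup>H * \<Delta>) \<in> carrier_mat n n" "?t \<cdot>\<^sub>m - (\<Delta> * B) \<in> carrier_mat n m"
    "?t \<cdot>\<^sub>m - (B\<^sup>H * \<Delta>) \<in> carrier_mat m n" "?t \<cdot>\<^sub>m 0\<^sub>m m m \<in> carrier_mat m m"
    by (rule carrier_matI; simp only: mat_ring_simps dim0 dimD)+
  show ?thesis
    unfolding Wc_def dW_def smult_four_block_mat[OF dW_blocks zero_carrier_mat]
      add_four_block_mat[OF c R(1) c']
    by (rule cong_four_block_mat)
      (simp_all only: mat_ring_simps mat_mult_smult mat_smult_add mat_smult_uminus dim0 dimD smult_zero_mat)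
qed

text \<open>The upper right block gives \<open>\<Delta> * B = 0\<close> and the upper left one the
  Lyapunov equation. This injectivity on Hermitian matrices is what makes the minimizer
  strict.\<close>

lemma dW_eq_0:
  assumes "controllable A B" "dW \<Delta> = 0\<^sub>m (n + m) (n + m)"
  shows "\<Delta> = 0\<^sub>m n n"
proof (rule controllable_lyapunov_eq_0[OF A B assms(1) Delta])
  have entry: "dW \<Delta> $$ (i, j) = 0" if "i < n + m" "j < n + m" for i j
    using assms(2) that by simp
  show "\<Delta> * B = 0\<^sub>m n m"
  proof (rule eq_matI)
    fix i j assume ij: "i < dim_row (0\<^sub>m n m :: complex mat)" "j < dim_col (0\<^sub>m n m :: complex mat)"
    then have "dW \<Delta> $$ (i, n + j) = - (\<Delta> * B) $$ (i, j)"
      using dW_blocks dim0 dimD by (simp add: dW_def)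
    with entry[of i "n + j"] ij show "(\<Delta> * B) $$ (i, j) = 0\<^sub>m n m $$ (i, j)" by simp
  qed (simp_all add: dim0 dimD)
  show "\<Delta> * A + A\<^sup>H * \<Delta> = 0\<^sub>m n n"
  proof (rule eq_matI)
    fix i j assume ij: "i < dim_row (0\<^sub>m n n :: complex mat)" "j < dim_col (0\<^sub>m n n :: complex mat)"
    then have "dW \<Delta> $$ (i, j) = - ((\<Delta> * A + A\<^sup>H * \<Delta>) $$ (i, j))"
      using dW_blocks dim0 dimD by (simp add: dW_def)
    moreover have "dW \<Delta> $$ (i, j) = 0" using entry[of i j] ij by simp
    ultimately have "(\<Delta> * A + A\<^sup>H * \<Delta>) $$ (i, j) = 0" by (metis neg_equal_0_iff_equal)
    with ij show "(\<Delta> * A + A\<^sup>H * \<Delta>) $$ (i, j) = 0\<^sub>m n n $$ (i, j)" by simp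
  qed (simp_all add: dim0 dimD)
qed

lemma trace_dW: "mat_trace (mat_inv W * dW \<Delta>) = - mat_trace (\<Delta> * G)"
proof -
  let ?V' = "four_block_mat (mat_inv P) (0\<^sub>m n m) (0\<^sub>m m n) (mat_inv R)"
  have V': "?V' \<in> carrier_mat (n + m) (n + m)"
    using four_block_carrier_mat[OF P_inv(1) R_inv(1)] by auto
  note dims = carrier_matD[OF V'] carrier_matD[OF T_carrier] carrier_matD[OF dW(1)]
  define N where "N = - (\<Delta> * AF) - AF\<^sup>H * \<Delta>"
  have N: "N \<in> carrier_mat n n"
    unfolding N_def by (rule carrier_matI; simp only: mat_ring_simps dim1 dimD)
  have dW_T: "dW \<Delta> * T = four_block_mat (- (\<Delta> * A) - A\<^sup>H * \<Delta> + \<Delta> * B * F) (- (\<Delta> * B)) (- (B\<^sup>H * \<Delta>)) (0\<^sub>m m m)"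
  proof -
    have "dW \<Delta> * T = four_block_mat ((- (\<Delta> * A) - A\<^sup>H * \<Delta>) * 1\<^sub>m n + - (\<Delta> * B) * - F)
        ((- (\<Delta> * A) - A\<^sup>H * \<Delta>) * 0\<^sub>m n m + - (\<Delta> * B) * 1\<^sub>m m)
        (- (B\<^sup>H * \<Delta>) * 1\<^sub>m n + 0\<^sub>m m m * - F) (- (B\<^sup>H * \<Delta>) * 0\<^sub>m n m + 0\<^sub>m m m * 1\<^sub>m m)"
      unfolding dW_def T_def
      by (rule mult_four_block_mat[OF dW_blocks zero_carrier_mat one_carrier_mat zero_carrier_mat
            F_carrier(2) one_carrier_mat])
    also have "\<dots> = four_block_mat (- (\<Delta> * A) - A\<^sup>H * \<Delta> + \<Delta> * B * F) (- (\<Delta> * B)) (- (B\<^sup>H * \<Delta>)) (0\<^sub>m m m)"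
      by (rule cong_four_block_mat) (simp_all only: mat_ring_simps dim0 dimF dimD)
    finally show ?thesis .
  qed
  have c1: "- (\<Delta> * A) - A\<^sup>H * \<Delta> + \<Delta> * B * F \<in> carrier_mat n n"
    by (rule carrier_matI; simp only: mat_ring_simps dim0 dimF dimD)
  have T_dW_T: "T\<^sup>H * (dW \<Delta> * T) = four_block_mat N (- (\<Delta> * B)) (- (B\<^sup>H * \<Delta>)) (0\<^sub>m m m)"
  proof -
    have "T\<^sup>H * (dW \<Delta> * T) = four_block_mat
        (1\<^sub>m n * (- (\<Delta> * A) - A\<^sup>H * \<Delta> + \<Delta> * B * F) + - (F\<^sup>H) * - (B\<^sup>H * \<Delta>))
        (1\<^sub>m n * - (\<Delta> * B) + - (F\<^sup>H) * 0\<^sub>m m m)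
        (0\<^sub>m m n * (- (\<Delta> * A) - A\<^sup>H * \<Delta> + \<Delta> * B * F) + 1\<^sub>m m * - (B\<^sup>H * \<Delta>))
        (0\<^sub>m m n * - (\<Delta> * B) + 1\<^sub>m m * 0\<^sub>m m m)"
      unfolding dW_T T_adjoint
      by (rule mult_four_block_mat[OF one_carrier_mat F_carrier(3) zero_carrier_mat one_carrier_mat
            c1 dW_blocks(2,3) zero_carrier_mat])
    also have "\<dots> = four_block_mat N (- (\<Delta> * B)) (- (B\<^sup>H * \<Delta>)) (0\<^sub>m m m)"
      unfolding N_def AFc_def
      by (rule cong_four_block_mat) (simp_all only: mat_ring_simps dim0 dimF dimD)
    finally show ?thesis .
  qed
  have "mat_trace (mat_inv W * dW \<Delta>) = mat_trace (T * (?V' * (T\<^sup>H * dW \<Delta>)))"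
    unfolding mat_inv_W by (simp only: mat_mult_assoc index_mult_mat dim_mat_adjoint dims)
  \<comment> \<open>Cyclicity brings \<open>T\<close> next to \<open>dW \<Delta>\<close>, so that
    the conjugated direction appears.\<close>
  also have "\<dots> = mat_trace ((?V' * (T\<^sup>H * dW \<Delta>)) * T)"
    by (rule mat_trace_mult_commute[of _ "n + m" "n + m"])
      (rule carrier_matI; simp only: index_mult_mat dim_mat_adjoint dims)+
  also have "(?V' * (T\<^sup>H * dW \<Delta>)) * T = ?V' * (T\<^sup>H * (dW \<Delta> * T))"
    by (simp only: mat_mult_assoc index_mult_mat dim_mat_adjoint dims)
  also have "\<dots> = four_block_mat (mat_inv P * N + 0\<^sub>m n m * - (B\<^sup>H * \<Delta>)) (mat_inv P * - (\<Delta> * B) + 0\<^sub>m n m * 0\<^sub>m m m)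
      (0\<^sub>m m n * N + mat_inv R * - (B\<^sup>H * \<Delta>)) (0\<^sub>m m n * - (\<Delta> * B) + mat_inv R * 0\<^sub>m m m)"
    unfolding T_dW_T
    by (rule mult_four_block_mat[OF P_inv(1) zero_carrier_mat zero_carrier_mat R_inv(1) N
          dW_blocks(2,3) zero_carrier_mat])
  also have "mat_trace \<dots> = mat_trace (mat_inv P * N + 0\<^sub>m n m * - (B\<^sup>H * \<Delta>)) + mat_trace (0\<^sub>m m n * - (\<Delta> * B) + mat_inv R * 0\<^sub>m m m)"
    by (rule mat_trace_four_block[of _ n _ m])
      (rule carrier_matI; simp only: mat_ring_simps dim0 dimD carrier_matD[OF N] dimPi carrier_matD[OF R_inv(1)])+
  also have "0\<^sub>m m n * - (\<Delta> * B) + mat_inv R * 0\<^sub>m m m = 0\<^sub>m m m"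
    by (simp only: mat_ring_simps dim0 dimD carrier_matD[OF R_inv(1)])
  also have "mat_trace (0\<^sub>m m m) = 0" by (simp add: mat_trace_def)
  also have "mat_inv P * N + 0\<^sub>m n m * - (B\<^sup>H * \<Delta>) = - (mat_inv P * (\<Delta> * AF) + (mat_inv P * AF\<^sup>H) * \<Delta>)"
    unfolding N_def by (simp only: mat_ring_simps dim0 dim1 dimD dimPi)
  also have "mat_trace \<dots> = - (mat_trace (mat_inv P * (\<Delta> * AF)) + mat_trace ((mat_inv P * AF\<^sup>H) * \<Delta>))"
  proof -
    have c: "mat_inv P * (\<Delta> * AF) \<in> carrier_mat n n" "(mat_inv P * AF\<^sup>H) * \<Delta> \<in> carrier_mat n n"
      "mat_inv P * (\<Delta> * AF) + (mat_inv P * AF\<^sup>H) * \<Delta> \<in> carrier_mat n n"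
      by (rule carrier_matI; simp only: mat_ring_simps dim1 dimD dimPi)+
    show ?thesis by (simp only: mat_trace_uminus[OF c(3)] mat_trace_add[OF c(1,2)])
  qed
  also have "mat_trace (mat_inv P * (\<Delta> * AF)) = mat_trace (\<Delta> * (AF * mat_inv P))"
  proof -
    have "mat_trace (mat_inv P * (\<Delta> * AF)) = mat_trace ((\<Delta> * AF) * mat_inv P)"
      by (rule mat_trace_mult_commute[of _ n n]) (rule carrier_matI; simp only: mat_ring_simps dim1 dimD dimPi)+
    then show ?thesis by (simp only: mat_mult_assoc dim1 dimD dimPi)
  qed
  also have "mat_trace ((mat_inv P * AF\<^sup>H) * \<Delta>) = mat_trace (\<Delta> * (mat_inv P * AF\<^sup>H))"
    by (rule mat_trace_mult_commute[of _ n n]) (rule carrier_matI; simp only: mat_ring_simps dim1 dimD dimPi)+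
  also have "mat_trace (\<Delta> * (AF * mat_inv P)) + mat_trace (\<Delta> * (mat_inv P * AF\<^sup>H)) = mat_trace (\<Delta> * G)"
  proof -
    have "\<Delta> * (AF * mat_inv P) \<in> carrier_mat n n" "\<Delta> * (mat_inv P * AF\<^sup>H) \<in> carrier_mat n n"
      by (rule carrier_matI; simp only: mat_ring_simps dim1 dimD dimPi)+
    from mat_trace_add[OF this] show ?thesis
      by (simp only: mat_distrib_left index_mult_mat index_add_mat dim_mat_adjoint dim1 dimD dimPi)
  qed
  finally show ?thesis by simp
qed

end

section \<open>Critical points and the analytic center\<close>

lemma critical_iff: "P * AF + AF\<^sup>H * P = 0\<^sub>m n n \<longleftrightarrow> G = 0\<^sub>m n n"
proof
  assume *: "P * AF + AF\<^sup>H * P = 0\<^sub>m n n"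
  \<comment> \<open>Congruence with the Hermitian matrix \<open>mat_inv P\<close>; the converse
    undoes it by congruence with \<open>P\<close>.\<close>
  have "G = mat_inv P * (P * AF + AF\<^sup>H * P) * mat_inv P"
    by (simp only: mat_ring_simps dim1 dimPi P_inv mat_inverse_cancel[OF P_inv(3)])
  also have "\<dots> = 0\<^sub>m n n"
    unfolding * by (simp only: mat_ring_simps dimPi)
  finally show "G = 0\<^sub>m n n" .
next
  assume *: "G = 0\<^sub>m n n"
  have "P * AF + AF\<^sup>H * P = P * G * P"
    by (simp only: mat_ring_simps dim1 dimPi P_inv mat_inverse_cancel[OF P_inv(2)])
  also have "\<dots> = 0\<^sub>m n n"
    unfolding * by (simp only: mat_ring_simps dim1)
  finally show "P * AF + AF\<^sup>H * P = 0\<^sub>m n n" .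
qed

text \<open>Moving against the gradient makes the first-order change of the determinant proportional
  to the squared Frobenius norm of \<open>G\<close>; a short enough step stays feasible and has a
  smaller barrier.\<close>

lemma center_imp_critical:
  assumes center: "is_analytic_center A B C D X"
  shows "G = 0\<^sub>m n n"
proof (rule ccontr)
  assume G0: "G \<noteq> 0\<^sub>m n n"
  define \<Delta> where "\<Delta> = - G"
  have dG: "dim_row G = n" "dim_col G = n" using carrier_matD[OF G(1)] .
  have \<Delta>: "\<Delta> \<in> carrier_mat n n" "\<Delta>\<^sup>H = \<Delta>"
    unfolding \<Delta>_def using G(1) by (simp_all only: uminus_carrier_iff_mat mat_adjoint_uminus G(2))
  have "\<Delta> * G = - (G\<^sup>H * G)"
    unfolding \<Delta>_def by (simp only: mat_mult_uminus G(2) dG)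
  moreover have "G\<^sup>H * G \<in> carrier_mat n n"
    by (rule carrier_matI) (simp_all only: index_mult_mat dim_mat_adjoint dG)
  ultimately have "mat_trace (mat_inv W * dW \<Delta>) = mat_trace (G\<^sup>H * G)"
    by (simp only: trace_dW[OF \<Delta>] mat_trace_uminus minus_minus)
  moreover have "0 < Re (mat_trace (G\<^sup>H * G))"
    using mat_trace_adjoint_mult_eq_0[OF G(1)] G0 by (meson linorder_not_less)
  ultimately have tr: "0 < Re (mat_trace (mat_inv W * dW \<Delta>))" by simp
  interpret W: hermitian_pencil W "dW \<Delta>" "n + m"
    by unfold_locales (fact X W_carrier dW[OF \<Delta>])+
  interpret X: hermitian_pencil X \<Delta> n
    by unfold_locales (fact X \<Delta>)+
  obtain e1 where e1: "0 < e1" "\<And>t. \<bar>t\<bar> < e1 \<Longrightarrow> positive_definite (W + complex_of_real t \<cdot>\<^sub>m dW \<Delta>)"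
    using W.positive_definite_perturbation by metis
  obtain e2 where e2: "0 < e2" "\<And>t. \<bar>t\<bar> < e2 \<Longrightarrow> positive_definite (X + complex_of_real t \<cdot>\<^sub>m \<Delta>)"
    using X.positive_definite_perturbation by metis
  obtain e3 where e3: "0 < e3"
    "\<And>t. 0 < t \<Longrightarrow> t < e3 \<Longrightarrow> Re (det W) < Re (det (W + complex_of_real t \<cdot>\<^sub>m dW \<Delta>))"
    using W.det_perturbation_increasing[OF tr] by metis
  \<comment> \<open>Half of the least radius is positive and strictly below the radii for
    \<open>W\<close>, for \<open>X\<close> and for the growth of the determinant.\<close>
  define t where "t = min e1 (min e2 e3) / 2"
  have t: "0 < t" "\<bar>t\<bar> < e1" "\<bar>t\<bar> < e2" "t < e3" using e1(1) e2(1) e3(1) by (auto simp: t_def)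
  define Y where "Y = X + complex_of_real t \<cdot>\<^sub>m \<Delta>"
  have WY: "Wc A B C D Y = W + complex_of_real t \<cdot>\<^sub>m dW \<Delta>"
    unfolding Y_def by (rule Wc_perturbation[OF \<Delta>])
  have Yc: "Y \<in> carrier_mat n n" unfolding Y_def using X(1) \<Delta>(1) by simp
  have Y: "Y \<in> Xc A B C D"
    using e1(2)[OF t(2)] e2(2)[OF t(3)] Yc positive_definite_iff[OF Yc] WY
    by (simp add: Xc_def dim0 Y_def[symmetric])
  have "0 < Re (det W)" by (rule positive_definite_det(2)[OF X(3) W_carrier])
  with e3(2)[OF t(1,4)] have "barrier A B C D Y < barrier A B C D X"
    unfolding barrier_def WY by simp
  with center Y show False
    unfolding is_analytic_center_iff by (metis less_asym)
qed

text \<open>Any competitor is reached at \<open>t = 1\<close> along the Hermitian direction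
  \<open>Y - X\<close>, whose trace vanishes because \<open>G\<close> does; thus the determinant
  estimate compares \<open>X\<close> with it directly.\<close>

lemma critical_imp_center:
  assumes ctrl: "controllable A B" and G0: "G = 0\<^sub>m n n"
  shows "is_analytic_center A B C D X"
  unfolding is_analytic_center_iff
proof (intro conjI ballI impI X_Xc)
  fix Y assume Y: "Y \<in> Xc A B C D" "Y \<noteq> X"
  then have Yc: "Y \<in> carrier_mat n n" "Y\<^sup>H = Y" "positive_definite (Wc A B C D Y)"
    by (auto simp: Xc_def dim0)
  define \<Delta> where "\<Delta> = Y - X"
  have YX: "Y = X + complex_of_real 1 \<cdot>\<^sub>m \<Delta>"
    using Yc(1) X(1) by (intro eq_matI) (auto simp: \<Delta>_def)
  have \<Delta>: "\<Delta> \<in> carrier_mat n n" "\<Delta>\<^sup>H = \<Delta>"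
    using Yc X carrier_matD[OF Yc(1)] unfolding \<Delta>_def
    by (simp_all add: mat_minus_conv mat_adjoint_add dim0)
  have WY: "Wc A B C D Y = W + dW \<Delta>"
    unfolding YX Wc_perturbation[OF \<Delta>] using dW(1)[OF \<Delta>] W_carrier by (intro eq_matI) auto
  interpret W: hermitian_pencil W "dW \<Delta>" "n + m"
    by unfold_locales (fact X W_carrier dW[OF \<Delta>])+
  have "\<Delta> \<noteq> 0\<^sub>m n n"
    using YX Y(2) X(1) by (auto simp: mat_add_zero dim0)
  then have "dW \<Delta> \<noteq> 0\<^sub>m (n + m) (n + m)"
    using dW_eq_0[OF \<Delta> ctrl] by blast
  moreover have "mat_trace (mat_inv W * dW \<Delta>) = 0"
    unfolding trace_dW[OF \<Delta>] G0 using \<Delta>(1) by (simp add: mat_trace_def)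
  ultimately have "Re (det (Wc A B C D Y)) < Re (det W)"
    using W.det_add_less Yc(3) unfolding WY by blast
  \<comment> \<open>Places both determinants in the range where \<open>ln\<close> is strictly
    increasing.\<close>
  moreover have "0 < Re (det (Wc A B C D Y))"
    by (rule positive_definite_det(2)[OF Yc(3), of "n + m"]) (use WY W_carrier dW(1)[OF \<Delta>] in simp)
  ultimately show "barrier A B C D X < barrier A B C D Y"
    by (simp add: barrier_def)
qed

text \<open>The critical equation says that \<open>AF\<close> is skew in the inner product of
  \<open>P\<close>; conjugation with the root of \<open>P\<close> carries this over to the standard
  inner product.\<close>

lemma critical_imp_skew_hermitian:
  assumes "P * AF + AF\<^sup>H * P = 0\<^sub>m n n"
  shows "skew_hermitian (pd_sqrt P * AF * mat_inv (pd_sqrt P))"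
proof -
  define Q where "Q = pd_sqrt P"
  have Q: "Q \<in> carrier_mat n n" "positive_definite Q" "Q * Q = P" "Q\<^sup>H = Q"
    using pd_sqrt[OF P_pd P_carrier] by (auto simp: Q_def positive_definite_iff)
  note Qi = positive_definite_mat_inv[OF Q(2,1)]
  note dims = carrier_matD[OF Q(1)] carrier_matD[OF Qi(1)] dim1
  have c: "P * AF \<in> carrier_mat n n" "AF\<^sup>H * P \<in> carrier_mat n n"
    by (rule carrier_matI; simp only: mat_ring_simps dim1)+
  have AP: "AF\<^sup>H * P = - (P * AF)"
    using assms mat_add_eq_0_iff[OF c] by blast
  \<comment> \<open>The trailing \<open>Q\<close> of the adjoint is written as
    \<open>P * mat_inv Q\<close> to expose \<open>AF\<^sup>H * P\<close>.\<close>
  have "(Q * AF * mat_inv Q)\<^sup>H = mat_inv Q * (AF\<^sup>H * P) * mat_inv Q"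
    unfolding Q(3)[symmetric] by (simp only: mat_ring_simps dims Q(4) Qi)
  also have "\<dots> = - (Q * AF * mat_inv Q)"
    unfolding AP unfolding Q(3)[symmetric] by (simp only: mat_ring_simps dims mat_inverse_cancel[OF Qi(3)])
  finally show ?thesis
    unfolding skew_hermitian_def Q_def[symmetric] by (simp add: dims)
qed

text \<open>For an eigenvector \<open>v\<close> the form of \<open>P * AF + AF\<^sup>H * P\<close>
  at \<open>v\<close> is \<open>l + cnj l\<close> times that of \<open>P\<close>, and the latter is
  nonzero.\<close>

lemma critical_imp_eigenvalue_imaginary:
  assumes "P * AF + AF\<^sup>H * P = 0\<^sub>m n n" and "eigenvalue AF l"
  shows "Re l = 0"
proof -
  from assms(2) obtain v where v: "v \<in> carrier_vec n" "v \<noteq> 0\<^sub>v n" and ev: "AF *\<^sub>v v = l \<cdot>\<^sub>v v"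
    by (auto simp: eigenvalue_def eigenvector_def dim1)
  have AF: "AF \<in> carrier_mat n n" "AF\<^sup>H \<in> carrier_mat n n"
    by (rule carrier_matI; simp only: dim1 dim_mat_adjoint)+
  define p where "p = P *\<^sub>v v"
  have p: "p \<in> carrier_vec n" using P_carrier v(1) by (auto simp: p_def)
  define q where "q = p \<bullet>c v"
  have q: "0 < Re q"
    using P_pd v by (auto simp: positive_definite_iff[OF P_carrier] q_def p_def)
  have c: "P * AF \<in> carrier_mat n n" "AF\<^sup>H * P \<in> carrier_mat n n"
    by (rule carrier_matI; simp only: mat_ring_simps dim1)+
  have AP: "AF\<^sup>H * P = - (P * AF)"
    using assms mat_add_eq_0_iff[OF c] by blast
  have "AF\<^sup>H *\<^sub>v p = (AF\<^sup>H * P) *\<^sub>v v"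
    unfolding p_def by (rule assoc_mult_mat_vec[OF AF(2) P_carrier v(1), symmetric])
  also have "\<dots> = - ((P * AF) *\<^sub>v v)"
    unfolding AP by (rule uminus_mult_mat_vec) (use v(1) in \<open>simp add: dim1\<close>)
  also have "(P * AF) *\<^sub>v v = l \<cdot>\<^sub>v p"
    unfolding assoc_mult_mat_vec[OF P_carrier AF(1) v(1)] ev p_def
    by (rule mult_mat_vec[OF P_carrier v(1)])
  finally have "(AF\<^sup>H *\<^sub>v p) \<bullet>c v = - (l * q)"
    using p v(1) by (simp add: q_def)
  moreover have "(AF\<^sup>H *\<^sub>v p) \<bullet>c v = cnj l * q"
    using cscalar_prod_adjoint[OF AF(2) p v(1)] p v(1)
    by (simp add: ev q_def conjugate_smult_vec)
  ultimately have "(l + cnj l) * q = 0" by (simp add: algebra_simps)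
  with q have "l + cnj l = 0" by auto
  then show ?thesis by (simp add: complex_eq_iff)
qed

end

theorem mainTheorem1:
  fixes A B C D :: "complex mat" and n m :: nat
  assumes "A \<in> carrier_mat n n" "B \<in> carrier_mat n m"
    and "C \<in> carrier_mat m n" "D \<in> carrier_mat m m"
    and "minimal_system A B C"
    and "vec_space.rank n B = m" "vec_space.rank m C = m"
    and "Xc A B C D \<noteq> {}"
  shows "\<forall>X \<in> Xc A B C D.
    let P = Pc A B C D X; A\<^sub>F = AFc A B C D X in
      positive_definite P \<and>
      (is_analytic_center A B C D X \<longleftrightarrow> P * A\<^sub>F + A\<^sub>F\<^sup>H * P = 0\<^sub>m n n) \<and>
      (P * A\<^sub>F + A\<^sub>F\<^sup>H * P = 0\<^sub>m n n \<longleftrightarrow>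
         mat_inv P * A\<^sub>F\<^sup>H + A\<^sub>F * mat_inv P = 0\<^sub>m n n) \<and>
      (is_analytic_center A B C D X \<longrightarrow>
         skew_hermitian (pd_sqrt P * A\<^sub>F * mat_inv (pd_sqrt P)) \<and>
         (\<forall>l. eigenvalue A\<^sub>F l \<longrightarrow> Re l = 0))"
proof
  fix X assume "X \<in> Xc A B C D"
  then interpret kyp_point A B C D X n m
    using assms by unfold_locales
  have ctrl: "controllable A B" using assms(5) by (simp add: minimal_system_def)
  have center: "is_analytic_center A B C D X \<longleftrightarrow> P * AF + AF\<^sup>H * P = 0\<^sub>m n n"
    using center_imp_critical critical_imp_center[OF ctrl] critical_iff by blast
  have comm: "mat_inv P * AF\<^sup>H + AF * mat_inv P = G"
    by (rule mat_add_commute) (simp_all only: mat_ring_simps dim1 dimPi)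
  show "let P = Pc A B C D X; A\<^sub>F = AFc A B C D X in
      positive_definite P \<and>
      (is_analytic_center A B C D X \<longleftrightarrow> P * A\<^sub>F + A\<^sub>F\<^sup>H * P = 0\<^sub>m n n) \<and>
      (P * A\<^sub>F + A\<^sub>F\<^sup>H * P = 0\<^sub>m n n \<longleftrightarrow>
         mat_inv P * A\<^sub>F\<^sup>H + A\<^sub>F * mat_inv P = 0\<^sub>m n n) \<and>
      (is_analytic_center A B C D X \<longrightarrow>
         skew_hermitian (pd_sqrt P * A\<^sub>F * mat_inv (pd_sqrt P)) \<and>
         (\<forall>l. eigenvalue A\<^sub>F l \<longrightarrow> Re l = 0))"
    unfolding Let_def comm
    using P_pd center critical_iff critical_imp_skew_hermitian critical_imp_eigenvalue_imaginary
    by blast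
qed

end
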